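(* Let $n\geq 2$, $r\geq 1$, $0\leq i\leq r-1$ and $A=\{0,\ldots,i\}$. Let $T$ be a connected simple graph satisfying property $\mathcal{P}$. Then for any positive integer $m\leq \chi(T)$, $\mathcal{N}(K_m^{T_A^r})\simeq \mathbb{S}^{m-2}$ (homotopy equivalence). In particular, $\mathcal{N}(K_m^{M_r(K_n)})\simeq \mathbb{S}^{m-2}$ for all positive integers $m\leq n$ (where $r\ge 2$, so that $M_r$ is defined).
   Context: All graphs are finite, undirected, without multiple edges; loops are allowed unless the graph is called simple (no loops). $E(G)\subseteq V(G)\times V(G)$ is the symmetric edge relation, and $x \sim y$ means $(x,y)\in E(G)$. $K_n$ is the complete graph on $\{1,\dots,n\}$ (no loops). The chromatic number $\chi(G)$ of a simple graph $G$ is the least $n$ such that there is a graph homomorphism (edge-preserving vertex map) $G\to K_n$. $\mathbb{S}^k$ denotes the $k$-dimensional sphere. Property $\mathcal{P}$: a simple graph $G$ satisfies $\mathcal{P}$ if for any two edges $(v_1,w_1)$ and $(v_2,w_2)$ of $G$ with $\{v_1,w_1\}\cap\{v_2,w_2\}=\emptyset$, if $(v_2,v_1)\in E(G)$ then $(w_2,v_1)\in E(G)$ or $(w_2,w_1)\in E(G)$. Categorical product: $G\times H$ has vertex set $V(G)\times V(H)$, with $(g,h)\sim(g',h')$ iff $g\sim g'$ in $G$ and $h\sim h'$ in $H$. For $r\ge1$, $L_r$ is the path with vertex set $\{0,\dots,r\}$ and edges $i\sim i+1$ for $0\le i\le r-1$. For $A\subseteq\{0,\dots,r\}$, $L_r(A)$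 is $L_r$ with a loop added at each $x\in A$. For a graph $G$, $G_A^r=(G\times L_r(A))/\sim_r$, where $\sim_r$ identifies all vertices whose second coordinate is $r$ to a single vertex (two vertices of the quotient are adjacent iff some representatives are adjacent). For $r\ge 2$, $M_r(G)=G_{\{0\}}^r$ is the $r$-th generalised Mycielskian of $G$. Exponential graph: $H^G$ has as vertices all set maps $V(G)\to V(H)$, and $f\sim f'$ in $H^G$ iff $v\sim v'$ in $G$ implies $f(v)\sim f'(v')$ in $H$. Neighborhood complex: $\mathcal{N}(G)$ is the simplicial complex whose simplices are the subsets $A\subseteq V(G)$ having a common neighbor (some $x$ with $(x,a)\in E(G)$ for all $a\in A$), regarded as a topological space via its geometric realization.
   Formalization: T is additionally assumed to have at least one edge; this excludes only T a single vertex with m = 1, where K_1^{T_A^r} is a single looped vertex, so its neighborhood complex is a point and not the empty sphere S^{-1}. *)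

theory Defs
  imports
    "HOL-Analysis.Analysis"
    "Graph_Theory.Pair_Digraph"
    "Graph_Theory.Digraph_Component"
begin

text \<open>
  Graphs are records \<open>pair_pre_digraph\<close> with a vertex set \<open>pverts\<close> and an edge relation \<open>parcs\<close>.
  The locale predicate \<open>pair_pseudo_graph\<close> says: finite, with symmetric edge relation, loops
  allowed. The locale predicate \<open>pair_graph\<close> adds that there are no loops, i.e. the graph is simple.
\<close>

definition graph_hom ::
    "'a pair_pre_digraph \<Rightarrow> 'b pair_pre_digraph \<Rightarrow> ('a \<Rightarrow> 'b) \<Rightarrow> bool" where
  "graph_hom G H f \<longleftrightarrow>
     f \<in> pverts G \<rightarrow> pverts H \<and> (\<forall>(x, y) \<in> parcs G. (f x, f y) \<in> parcs H)"

definition complete_graph :: "nat \<Rightarrow> nat pair_pre_digraph" where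
  "complete_graph n =
     \<lparr> pverts = {1..n}, parcs = {(x, y). x \<in> {1..n} \<and> y \<in> {1..n} \<and> x \<noteq> y} \<rparr>"

definition chromatic_number :: "'a pair_pre_digraph \<Rightarrow> nat" where
  "chromatic_number G = (LEAST n. \<exists>f. graph_hom G (complete_graph n) f)"

definition property_P :: "'a pair_pre_digraph \<Rightarrow> bool" where
  "property_P G \<longleftrightarrow>
     (\<forall>v1 w1 v2 w2. (v1, w1) \<in> parcs G \<and> (v2, w2) \<in> parcs G \<and> {v1, w1} \<inter> {v2, w2} = {} \<longrightarrow>
        (v2, v1) \<in> parcs G \<longrightarrow> (w2, v1) \<in> parcs G \<or> (w2, w1) \<in> parcs G)"

definition cat_prod ::
    "'a pair_pre_digraph \<Rightarrow> 'b pair_pre_digraph \<Rightarrow> ('a \<times> 'b) pair_pre_digraph" where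
  "cat_prod G H =
     \<lparr> pverts = pverts G \<times> pverts H,
       parcs = {((g, h), (g', h')) | g h g' h'. (g, g') \<in> parcs G \<and> (h, h') \<in> parcs H} \<rparr>"

definition looped_path :: "nat \<Rightarrow> nat set \<Rightarrow> nat pair_pre_digraph" where
  "looped_path r A =
     \<lparr> pverts = {0..r},
       parcs = {(i, i + 1) | i. i < r} \<union> {(i + 1, i) | i. i < r} \<union> {(x, x) | x. x \<in> A} \<rparr>"

definition quotient_graph ::
    "'a pair_pre_digraph \<Rightarrow> ('a \<times> 'a) set \<Rightarrow> 'a set pair_pre_digraph" where
  "quotient_graph G R =
     \<lparr> pverts = pverts G // R,
       parcs = {(X, Y). X \<in> pverts G // R \<and> Y \<in> pverts G // R \<and>
                        (\<exists>x \<in> X. \<exists>y \<in> Y. (x, y) \<in> parcs G)} \<rparr>"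

definition collapse_top :: "('a \<times> nat) set \<Rightarrow> nat \<Rightarrow> (('a \<times> nat) \<times> ('a \<times> nat)) set" where
  "collapse_top V r = {(p, q). p \<in> V \<and> q \<in> V \<and> (p = q \<or> snd p = r \<and> snd q = r)}"

text \<open>\<open>gen_cone G r A\<close> is the graph written $G_A^r$.\<close>

definition gen_cone ::
    "'a pair_pre_digraph \<Rightarrow> nat \<Rightarrow> nat set \<Rightarrow> ('a \<times> nat) set pair_pre_digraph" where
  "gen_cone G r A =
     (let P = cat_prod G (looped_path r A) in quotient_graph P (collapse_top (pverts P) r))"

definition mycielskian :: "nat \<Rightarrow> 'a pair_pre_digraph \<Rightarrow> ('a \<times> nat) set pair_pre_digraph" where
  "mycielskian r G = gen_cone G r {0}"

text \<open>
  \<open>exp_graph H G\<close> is $H^G$. A set map from \<open>pverts G\<close> to \<open>pverts H\<close> is represented by the unique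
  HOL function that extends it and is \<open>undefined\<close> outside \<open>pverts G\<close>.
\<close>

definition exp_graph ::
    "'b pair_pre_digraph \<Rightarrow> 'a pair_pre_digraph \<Rightarrow> ('a \<Rightarrow> 'b) pair_pre_digraph" where
  "exp_graph H G =
     \<lparr> pverts = pverts G \<rightarrow>\<^sub>E pverts H,
       parcs = {(f, f'). f \<in> pverts G \<rightarrow>\<^sub>E pverts H \<and> f' \<in> pverts G \<rightarrow>\<^sub>E pverts H \<and>
                         (\<forall>(v, v') \<in> parcs G. (f v, f' v') \<in> parcs H)} \<rparr>"

definition nbhd_complex :: "'a pair_pre_digraph \<Rightarrow> 'a set set" where
  "nbhd_complex G = {A. A \<subseteq> pverts G \<and> (\<exists>x \<in> pverts G. \<forall>a \<in> A. (x, a) \<in> parcs G)}"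

text \<open>
  Geometric realization by barycentric coordinates: a point is a weight function whose support is
  a simplex. A support that is empty or infinite is excluded because the sum over it is \<open>0\<close>; in
  particular the complex \<open>{{}}\<close> has empty realization. The topology is the one of coordinatewise
  convergence, which is the usual (weak) topology for finite complexes, in particular for
  neighborhood complexes of finite graphs.
\<close>

definition geom_realization :: "'a set set \<Rightarrow> ('a \<Rightarrow> real) topology" where
  "geom_realization K =
     subtopology (powertop_real UNIV)
       {\<alpha>. (\<forall>x. 0 \<le> \<alpha> x) \<and> {x. \<alpha> x \<noteq> 0} \<in> K \<and> (\<Sum>x | \<alpha> x \<noteq> 0. \<alpha> x) = 1}"

text \<open>The sphere of dimension \<open>k\<close>, with the usual convention that the $(-1)$-sphere is empty.\<close>

definition sphere_space :: "int \<Rightarrow> (nat \<Rightarrow> real) topology" where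
  "sphere_space k = (if k < 0 then trivial_topology else nsphere (nat k))"

end

theory Submission
  imports Defs
begin

text \<open>
  Write \<open>x \<sim> y\<close> for adjacency and \<open>L\<close> for the path \<open>0, \<dots>, r\<close> with loops at \<open>0, \<dots>, i\<close>. Two graph
  homomorphisms \<open>\<phi>, \<psi>\<close> are called adjacent if \<open>x \<sim> y\<close> implies \<open>\<phi> x \<sim> \<psi> y\<close>. Adjacent homomorphisms
  induce contiguous simplicial maps of neighborhood complexes: if \<open>x\<close> is a common neighbor of a
  simplex, then \<open>\<phi> x\<close> is a common neighbor of the union of its two images. Contiguous maps are joined
  by a straight-line homotopy. Hence a pair of homomorphisms that are inverse to each other up to
  finite chains of adjacent homomorphisms gives a homotopy equivalence of neighborhood complexes
  (\<open>homotopy_equivalent_nbhd_complexes\<close>). The theorem follows from a chain of three equivalences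
    \<^item> from \<open>K\<^sub>m\<close> to the power \<open>T\<^sub>A\<^sup>r\<close>, to \<open>K\<^sub>m\<close> to the power \<open>L\<close> (\<open>homotopy_equivalent_exp_path\<close>),
    \<^item> from there to \<open>K\<^sub>m\<close> itself (\<open>nbhd_complex_exp_looped_path\<close>),
    \<^item> from there to the sphere (\<open>complete_graph_sphere\<close>).
  
  The first step is where the hypotheses on \<open>T\<close> enter. For a connected graph with an edge, property P
  says that every edge dominates: each vertex is adjacent to an end of it
  (\<open>property_P_dominating\<close>). Let \<open>f \<sim> g\<close> in the exponential graph, and let \<open>f\<close> have the same color \<open>d\<close>
  at both ends of an edge of the copy of \<open>T\<close> at level \<open>j\<close>. Every vertex that has a neighbor at level
  \<open>j\<close> is then adjacent to an end of this edge, so \<open>g\<close> avoids \<open>d\<close> there. Therefore recoloring all of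
  level \<open>j\<close> with \<open>d\<close> turns \<open>f\<close> into a map that is still adjacent to \<open>g\<close>. Doing this level by level,
  starting from level \<open>0\<close>, deforms the exponential graph onto the maps that are constant on levels,
  and these are the maps on \<open>L\<close>.
  
  Such an edge exists at level \<open>j \<ge> 1\<close>, because \<open>g\<close> is constant on level \<open>j - 1\<close> already and \<open>f\<close> must
  avoid that constant on level \<open>j\<close>, while fewer than \<open>m\<close> colors do not suffice for a proper coloring
  of \<open>T\<close>. At level \<open>0\<close> suppose that \<open>f\<close> were a proper coloring. Since \<open>m\<close> colors are just enough and
  edges dominate, a proper coloring is adjacent to itself only (\<open>proper_coloring_rigid\<close>). Following
  the edges between the levels, \<open>f\<close> and \<open>g\<close> would coincide with this coloring on every level, which
  is impossible at the apex (\<open>bottom_monochromatic_edge\<close>).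
  
  In the second step \<open>L\<close> itself is folded: its top vertex \<open>r\<close> has the single neighbor \<open>r - 1\<close>, so it
  folds onto \<open>r - 2\<close>, or onto \<open>r - 1\<close> if there is a loop at \<open>r - 1\<close>. The new top vertex is treated in
  the same way until the looped vertex \<open>0\<close> remains. In the third step the neighborhood complex of
  \<open>K\<^sub>m\<close> is the boundary of a simplex, which is mapped to the sphere by projecting along the diagonal
  and normalizing.
\<close>

section \<open>Simplicial maps and homotopies of geometric realizations\<close>

definition finite_complex :: "'a set set \<Rightarrow> bool" where
  "finite_complex K \<longleftrightarrow> finite (\<Union>K) \<and> (\<forall>A\<in>K. \<forall>B\<subseteq>A. B \<in> K)"

definition weights :: "'a set set \<Rightarrow> ('a \<Rightarrow> real) set" where
  "weights K = {\<alpha>. (\<forall>x. 0 \<le> \<alpha> x) \<and> {x. \<alpha> x \<noteq> 0} \<in> K \<and> (\<Sum>x | \<alpha> x \<noteq> 0. \<alpha> x) = 1}"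

lemma topspace_geom_realization [simp]: "topspace (geom_realization K) = weights K"
  by (simp add: geom_realization_def weights_def)

lemma continuous_map_coordinate: "continuous_map (geom_realization K) euclideanreal (\<lambda>\<alpha>. \<alpha> x)"
  unfolding geom_realization_def
  by (intro continuous_map_from_subtopology continuous_map_product_projection) auto

lemma continuous_map_into_geom_realization:
  assumes "\<And>y. continuous_map X euclideanreal (\<lambda>\<xi>. f \<xi> y)"
    and "\<And>\<xi>. \<xi> \<in> topspace X \<Longrightarrow> f \<xi> \<in> weights K"
  shows "continuous_map X (geom_realization K) f"
  using assms unfolding geom_realization_def weights_def
  by (auto simp: continuous_map_in_subtopology continuous_map_componentwise_UNIV)

lemma support_finite: "finite_complex K \<Longrightarrow> \<alpha> \<in> weights K \<Longrightarrow> finite {x. \<alpha> x \<noteq> 0}"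
  unfolding finite_complex_def weights_def by (metis (no_types, lifting) Union_upper finite_subset mem_Collect_eq)

lemma weights_nonneg: "\<alpha> \<in> weights K \<Longrightarrow> 0 \<le> \<alpha> x"
  unfolding weights_def by simp

lemma support_nonempty: "\<alpha> \<in> weights K \<Longrightarrow> {x. \<alpha> x \<noteq> 0} \<noteq> {}"
  unfolding weights_def by force

text \<open>
  Membership can be checked on any simplex that contains the support, so the exact support need not
  be known.
\<close>

lemma weightsI:
  assumes "finite_complex K" "A \<in> K" "\<And>x. 0 \<le> \<alpha> x" "\<And>x. x \<notin> A \<Longrightarrow> \<alpha> x = 0" "sum \<alpha> A = 1"
  shows "\<alpha> \<in> weights K"
proof -
  have fin: "finite A"
    using assms(1,2) unfolding finite_complex_def by (metis Union_upper finite_subset)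
  have sub: "{x. \<alpha> x \<noteq> 0} \<subseteq> A" using assms(4) by auto
  have "(\<Sum>x | \<alpha> x \<noteq> 0. \<alpha> x) = sum \<alpha> A"
    by (rule sum.mono_neutral_left) (use fin sub in auto)
  with assms sub show ?thesis unfolding weights_def finite_complex_def by auto
qed

lemma weights_sum:
  assumes "\<alpha> \<in> weights K" "finite S" "{x. \<alpha> x \<noteq> 0} \<subseteq> S"
  shows "sum \<alpha> S = 1"
proof -
  have "(\<Sum>x | \<alpha> x \<noteq> 0. \<alpha> x) = sum \<alpha> S"
    by (rule sum.mono_neutral_left) (use assms in auto)
  with assms show ?thesis by (simp add: weights_def)
qed

text \<open>
  The affine extension of a vertex map: the weight of a point is carried along with its vertices.
\<close>

definition push :: "('a \<Rightarrow> 'b) \<Rightarrow> ('a \<Rightarrow> real) \<Rightarrow> 'b \<Rightarrow> real" where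
  "push \<phi> \<alpha> = (\<lambda>y. \<Sum>x | \<alpha> x \<noteq> 0 \<and> \<phi> x = y. \<alpha> x)"

lemma push_eq_sum:
  assumes "finite S" "{x. \<alpha> x \<noteq> 0} \<subseteq> S"
  shows "push \<phi> \<alpha> y = (\<Sum>x | x \<in> S \<and> \<phi> x = y. \<alpha> x)"
  unfolding push_def by (rule sum.mono_neutral_left) (use assms in auto)

lemma push_id: "push id = id"
proof (intro ext)
  fix \<alpha> :: "'a \<Rightarrow> real" and y
  have "{x. \<alpha> x \<noteq> 0 \<and> id x = y} = (if \<alpha> y = 0 then {} else {y})" by auto
  then show "push id \<alpha> y = id \<alpha> y" by (simp add: push_def)
qed

lemma push_nonneg: "(\<And>x. 0 \<le> \<alpha> x) \<Longrightarrow> 0 \<le> push \<phi> \<alpha> y"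
  unfolding push_def by (simp add: sum_nonneg)

lemma push_outside: "y \<notin> \<phi> ` {x. \<alpha> x \<noteq> 0} \<Longrightarrow> push \<phi> \<alpha> y = 0"
  unfolding push_def by (rule sum.neutral) auto

lemma push_sum:
  assumes "\<alpha> \<in> weights K" "finite_complex K" "finite B" "\<phi> ` {x. \<alpha> x \<noteq> 0} \<subseteq> B"
  shows "sum (push \<phi> \<alpha>) B = 1"
proof -
  let ?S = "{x. \<alpha> x \<noteq> 0}"
  have fin: "finite ?S" using support_finite assms by blast
  have "(\<Sum>y\<in>B. \<Sum>x | x \<in> ?S \<and> \<phi> x = y. \<alpha> x) = sum \<alpha> ?S"
    by (rule sum.group) (use fin assms in auto)
  then show ?thesis using assms(1) by (simp add: push_def weights_def)
qed

lemma push_comp: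
  assumes "finite {x. \<alpha> x \<noteq> 0}" "\<And>x. 0 \<le> \<alpha> x"
  shows "push \<psi> (push \<phi> \<alpha>) = push (\<psi> \<circ> \<phi>) \<alpha>"
proof
  fix z
  let ?S = "{x. \<alpha> x \<noteq> 0}" and ?T = "\<phi> ` {x. \<alpha> x \<noteq> 0}"
  have "push \<psi> (push \<phi> \<alpha>) z = (\<Sum>y | y \<in> ?T \<and> \<psi> y = z. push \<phi> \<alpha> y)"
    by (rule push_eq_sum) (use assms push_outside[of _ \<phi> \<alpha>] in auto)
  also have "\<dots> = (\<Sum>y | y \<in> ?T \<and> \<psi> y = z. \<Sum>x | x \<in> {x \<in> ?S. \<psi> (\<phi> x) = z} \<and> \<phi> x = y. \<alpha> x)"
    unfolding push_def by (intro sum.cong) auto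
  also have "\<dots> = sum \<alpha> {x \<in> ?S. \<psi> (\<phi> x) = z}"
    by (rule sum.group) (use assms in auto)
  finally show "push \<psi> (push \<phi> \<alpha>) z = push (\<psi> \<circ> \<phi>) \<alpha> z" by (simp add: push_def)
qed

text \<open>
  The case \<open>\<phi> = \<psi>\<close> says that \<open>\<phi>\<close> is simplicial. The empty simplex is left out because it carries no
  point of the realization, and because a graph without vertices has no neighborhood simplex at all.
\<close>

definition contiguous :: "'a set set \<Rightarrow> 'b set set \<Rightarrow> ('a \<Rightarrow> 'b) \<Rightarrow> ('a \<Rightarrow> 'b) \<Rightarrow> bool" where
  "contiguous K L \<phi> \<psi> \<longleftrightarrow> (\<forall>A\<in>K. A \<noteq> {} \<longrightarrow> \<phi> ` A \<union> \<psi> ` A \<in> L)"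

lemma continuous_map_push_coordinate:
  assumes "finite_complex K"
  shows "continuous_map (geom_realization K) euclideanreal (\<lambda>\<alpha>. push \<phi> \<alpha> y)"
proof -
  have fin: "finite (\<Union>K)" using assms by (simp add: finite_complex_def)
  have "continuous_map (geom_realization K) euclideanreal (\<lambda>\<alpha>. \<Sum>x | x \<in> \<Union>K \<and> \<phi> x = y. \<alpha> x)"
    by (intro continuous_map_sum continuous_map_coordinate) (use fin in \<open>auto simp del: Union_iff\<close>)
  then show ?thesis
  proof (rule continuous_map_eq)
    fix \<alpha> assume "\<alpha> \<in> topspace (geom_realization K)"
    then have "{x. \<alpha> x \<noteq> 0} \<subseteq> \<Union>K" by (auto simp: weights_def)
    then show "(\<Sum>x | x \<in> \<Union>K \<and> \<phi> x = y. \<alpha> x) = push \<phi> \<alpha> y"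
      using push_eq_sum[OF fin] by metis
  qed
qed

text \<open>
  For a point with support \<open>S\<close> the segment between its two images stays in the simplex spanned by
  \<open>\<phi> ` S \<union> \<psi> ` S\<close>.
\<close>

lemma contiguous_imp_homotopic:
  assumes K: "finite_complex K" and L: "finite_complex L" and c: "contiguous K L \<phi> \<psi>"
  shows "homotopic_with (\<lambda>_. True) (geom_realization K) (geom_realization L) (push \<phi>) (push \<psi>)"
proof -
  define h where "h = (\<lambda>(t::real, \<alpha>) y. (1 - t) * push \<phi> \<alpha> y + t * push \<psi> \<alpha> y)"
  let ?X = "prod_topology (top_of_set {0..1::real}) (geom_realization K)"
  have "continuous_map ?X (geom_realization L) h"
  proof (rule continuous_map_into_geom_realization)
    fix y
    have t: "continuous_map ?X euclideanreal fst"
      by (rule continuous_map_into_fulltopology[OF continuous_map_fst])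
    have p: "continuous_map ?X euclideanreal (\<lambda>\<xi>. push \<eta> (snd \<xi>) y)" for \<eta> :: "'a \<Rightarrow> 'b"
      using continuous_map_compose[OF continuous_map_snd continuous_map_push_coordinate[OF K]]
      by (simp add: o_def)
    show "continuous_map ?X euclideanreal (\<lambda>\<xi>. h \<xi> y)"
      unfolding h_def case_prod_unfold
      by (intro continuous_map_add continuous_map_real_mult continuous_map_diff continuous_map_const[THEN iffD2] t p) simp
  next
    fix \<xi> assume "\<xi> \<in> topspace ?X"
    then obtain t \<alpha> where \<xi>: "\<xi> = (t, \<alpha>)" and t: "0 \<le> t" "t \<le> 1" and \<alpha>: "\<alpha> \<in> weights K"
      by (cases \<xi>) auto
    let ?S = "{x. \<alpha> x \<noteq> 0}"
    let ?B = "\<phi> ` ?S \<union> \<psi> ` ?S"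
    have S: "?S \<in> K" "?S \<noteq> {}" using \<alpha> support_nonempty[OF \<alpha>] by (auto simp: weights_def)
    have nn: "0 \<le> \<alpha> x" for x using \<alpha> by (rule weights_nonneg)
    have BL: "?B \<in> L" by (rule c[unfolded contiguous_def, rule_format, OF S])
    have finB: "finite ?B" using support_finite[OF K \<alpha>] by simp
    have out: "push \<phi> \<alpha> y = 0" "push \<psi> \<alpha> y = 0" if "y \<notin> ?B" for y
      using that by (auto intro: push_outside)
    have "(\<Sum>y\<in>?B. (1 - t) * push \<phi> \<alpha> y + t * push \<psi> \<alpha> y)
        = (1 - t) * sum (push \<phi> \<alpha>) ?B + t * sum (push \<psi> \<alpha>) ?B"
      by (simp add: sum.distrib sum_distrib_left)
    also have "\<dots> = 1"
      using push_sum[OF \<alpha> K finB, of \<phi>] push_sum[OF \<alpha> K finB, of \<psi>] by simp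
    finally have one: "sum (h \<xi>) ?B = 1" by (simp add: h_def \<xi>)
    have "0 \<le> h \<xi> y" for y
      using t push_nonneg[of \<alpha> \<phi> y, OF nn] push_nonneg[of \<alpha> \<psi> y, OF nn] by (simp add: h_def \<xi>)
    moreover have "h \<xi> y = 0" if "y \<notin> ?B" for y
      unfolding h_def \<xi> prod.case out[OF that] by simp
    ultimately show "h \<xi> \<in> weights L"
      by (rule weightsI[OF L BL _ _ one])
  qed
  then show ?thesis
    unfolding homotopic_with_def by (intro exI[of _ h]) (simp add: h_def)
qed

lemma homotopic_to_id:
  assumes "finite_complex K" "(contiguous K K)\<^sup>*\<^sup>* \<phi> id"
  shows "homotopic_with (\<lambda>_. True) (geom_realization K) (geom_realization K) (push \<phi>) id"
  using assms(2)
proof (induction rule: converse_rtranclp_induct)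
  case base
  show ?case unfolding push_id by (simp only: homotopic_with_refl continuous_map_id)
next
  case (step \<phi> \<psi>)
  then show ?case using contiguous_imp_homotopic[OF assms(1) assms(1)] homotopic_with_trans by blast
qed

theorem homotopy_equivalent_realizations:
  assumes K: "finite_complex K" and L: "finite_complex L"
    and \<phi>: "contiguous K L \<phi> \<phi>" and \<psi>: "contiguous L K \<psi> \<psi>"
    and \<psi>\<phi>: "(contiguous K K)\<^sup>*\<^sup>* (\<psi> \<circ> \<phi>) id" and \<phi>\<psi>: "(contiguous L L)\<^sup>*\<^sup>* (\<phi> \<circ> \<psi>) id"
  shows "geom_realization K homotopy_equivalent_space geom_realization L"
proof -
  have cont: "continuous_map (geom_realization K) (geom_realization L) (push \<phi>)"
       "continuous_map (geom_realization L) (geom_realization K) (push \<psi>)"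
    using contiguous_imp_homotopic[OF K L \<phi>] contiguous_imp_homotopic[OF L K \<psi>]
    by (auto dest: homotopic_with_imp_continuous_maps)
  have 1: "homotopic_with (\<lambda>_. True) (geom_realization K) (geom_realization K) (push \<psi> \<circ> push \<phi>) id"
  proof (rule homotopic_with_eq[OF homotopic_to_id[OF K \<psi>\<phi>]])
    show "(push \<psi> \<circ> push \<phi>) \<alpha> = push (\<psi> \<circ> \<phi>) \<alpha>" if "\<alpha> \<in> topspace (geom_realization K)" for \<alpha>
      using that by (simp add: push_comp[OF support_finite[OF K]] weights_nonneg)
  qed auto
  have 2: "homotopic_with (\<lambda>_. True) (geom_realization L) (geom_realization L) (push \<phi> \<circ> push \<psi>) id"
  proof (rule homotopic_with_eq[OF homotopic_to_id[OF L \<phi>\<psi>]])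
    show "(push \<phi> \<circ> push \<psi>) \<alpha> = push (\<phi> \<circ> \<psi>) \<alpha>" if "\<alpha> \<in> topspace (geom_realization L)" for \<alpha>
      using that by (simp add: push_comp[OF support_finite[OF L]] weights_nonneg)
  qed auto
  show ?thesis
    unfolding homotopy_equivalent_space_def using cont 1 2 by blast
qed

section \<open>Adjacent graph homomorphisms\<close>

text \<open>
  These are adjacent looped vertices of the exponential graph; chains of them are the
  \<open>\<times>\<close>-homotopies of Dochtermann. Nothing is required of isolated vertices of the source, which
  belong to no simplex of the neighborhood complex.
\<close>

definition times_adjacent ::
    "'a pair_pre_digraph \<Rightarrow> 'b pair_pre_digraph \<Rightarrow> ('a \<Rightarrow> 'b) \<Rightarrow> ('a \<Rightarrow> 'b) \<Rightarrow> bool" where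
  "times_adjacent G H \<phi> \<psi> \<longleftrightarrow>
     (\<forall>(x, y) \<in> parcs G. (\<phi> x, \<phi> y) \<in> parcs H \<and> (\<psi> x, \<psi> y) \<in> parcs H \<and> (\<phi> x, \<psi> y) \<in> parcs H)"

lemma finite_complex_nbhd_complex: "finite (pverts G) \<Longrightarrow> finite_complex (nbhd_complex G)"
  unfolding finite_complex_def nbhd_complex_def
  by (rule conjI, rule finite_subset[of _ "pverts G"]) blast+

text \<open>
  A common neighbor \<open>x\<close> of a simplex is sent by \<open>\<phi>\<close> to a common neighbor of both of its images.
\<close>

lemma times_adjacent_imp_contiguous:
  assumes "pair_wf_digraph H" "times_adjacent G H \<phi> \<psi>"
  shows "contiguous (nbhd_complex G) (nbhd_complex H) \<phi> \<psi>"
  unfolding contiguous_def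
proof (intro ballI impI)
  fix A assume "A \<in> nbhd_complex G" "A \<noteq> {}"
  then obtain x where x: "\<And>a. a \<in> A \<Longrightarrow> (x, a) \<in> parcs G" by (auto simp: nbhd_complex_def)
  have adj: "(\<phi> x, b) \<in> parcs H" if "b \<in> \<phi> ` A \<union> \<psi> ` A" for b
    using that x assms(2) unfolding times_adjacent_def by fast
  then have "b \<in> pverts H" if "b \<in> \<phi> ` A \<union> \<psi> ` A" for b
    using that pair_wf_digraph.in_arcsD2[OF assms(1)] by metis
  moreover have "\<phi> x \<in> pverts H"
    using adj \<open>A \<noteq> {}\<close> pair_wf_digraph.in_arcsD1[OF assms(1)] by (metis UnI1 all_not_in_conv image_eqI)
  ultimately show "\<phi> ` A \<union> \<psi> ` A \<in> nbhd_complex H"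
    using adj unfolding nbhd_complex_def by blast
qed

lemma homotopy_equivalent_nbhd_complexes:
  assumes G: "pair_wf_digraph G" "finite (pverts G)" and H: "pair_wf_digraph H" "finite (pverts H)"
    and \<phi>: "times_adjacent G H \<phi> \<phi>" and \<psi>: "times_adjacent H G \<psi> \<psi>"
    and \<psi>\<phi>: "(times_adjacent G G)\<^sup>*\<^sup>* (\<psi> \<circ> \<phi>) id" and \<phi>\<psi>: "(times_adjacent H H)\<^sup>*\<^sup>* (\<phi> \<circ> \<psi>) id"
  shows "geom_realization (nbhd_complex G) homotopy_equivalent_space geom_realization (nbhd_complex H)"
proof (rule homotopy_equivalent_realizations[where \<phi> = \<phi> and \<psi> = \<psi>])
  show "(contiguous (nbhd_complex G) (nbhd_complex G))\<^sup>*\<^sup>* (\<psi> \<circ> \<phi>) id"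
    by (rule mono_rtranclp[rule_format, OF times_adjacent_imp_contiguous[OF G(1)] \<psi>\<phi>])
  show "(contiguous (nbhd_complex H) (nbhd_complex H))\<^sup>*\<^sup>* (\<phi> \<circ> \<psi>) id"
    by (rule mono_rtranclp[rule_format, OF times_adjacent_imp_contiguous[OF H(1)] \<phi>\<psi>])
qed (use assms in \<open>simp_all add: times_adjacent_imp_contiguous finite_complex_nbhd_complex\<close>)

section \<open>Complete graphs and spheres\<close>

lemma continuous_map_Min:
  assumes "finite I" "I \<noteq> {}" "\<And>i. i \<in> I \<Longrightarrow> continuous_map X euclideanreal (f i)"
  shows "continuous_map X euclideanreal (\<lambda>x. Min ((\<lambda>i. f i x) ` I))"
  using assms
proof (induction rule: finite_ne_induct)
  case (insert i I)
  then have "continuous_map X euclideanreal (\<lambda>x. min (f i x) (Min ((\<lambda>i. f i x) ` I)))"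
    by (intro continuous_map_real_min) auto
  with insert.hyps show ?case by simp
qed simp

lemma nbhd_complex_complete_graph:
  "nbhd_complex (complete_graph m) = {A. A \<subset> {1..m}}"
proof (intro set_eqI iffI)
  show "A \<in> {A. A \<subset> {1..m}}" if "A \<in> nbhd_complex (complete_graph m)" for A
    using that unfolding nbhd_complex_def complete_graph_def by auto
  show "A \<in> nbhd_complex (complete_graph m)" if "A \<in> {A. A \<subset> {1..m}}" for A
  proof -
    from that obtain x where "x \<in> {1..m}" "x \<notin> A" "A \<subseteq> {1..m}" by blast
    then show ?thesis unfolding nbhd_complex_def complete_graph_def by force
  qed
qed

lemma pair_wf_digraph_complete_graph: "pair_wf_digraph (complete_graph m)"
  by unfold_locales (auto simp: complete_graph_def)

lemma weights_complete_graph: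
  "weights (nbhd_complex (complete_graph m)) =
    {\<alpha>. (\<forall>x. 0 \<le> \<alpha> x) \<and> (\<forall>x. x \<notin> {1..m} \<longrightarrow> \<alpha> x = 0) \<and> (\<exists>x\<in>{1..m}. \<alpha> x = 0) \<and> sum \<alpha> {1..m} = 1}"
    (is "_ = ?R")
proof (intro set_eqI iffI)
  fix \<alpha> assume a: "\<alpha> \<in> weights (nbhd_complex (complete_graph m))"
  then have S: "{x. \<alpha> x \<noteq> 0} \<subset> {1..m}" by (simp add: weights_def nbhd_complex_complete_graph)
  then obtain x where "x \<in> {1..m}" "\<alpha> x = 0" by blast
  moreover have "sum \<alpha> {1..m} = 1" using weights_sum[OF a] S by auto
  ultimately show "\<alpha> \<in> ?R" using S weights_nonneg[OF a] by blast
next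
  fix \<alpha> assume a: "\<alpha> \<in> ?R"
  then obtain x where x: "x \<in> {1..m}" "\<alpha> x = 0" by auto
  have "sum \<alpha> ({1..m} - {x}) = 1" using a x by (simp add: sum_diff1)
  then show "\<alpha> \<in> weights (nbhd_complex (complete_graph m))"
    using a x
    by (intro weightsI[of _ "{1..m} - {x}"] finite_complex_nbhd_complex)
       (auto simp: nbhd_complex_complete_graph, auto simp: complete_graph_def)
qed

text \<open>
  The boundary of the simplex on \<open>{1..k+2}\<close> consists of the weights with minimum \<open>0\<close>. Translation
  along the diagonal moves the last coordinate to \<open>0\<close>; it is undone by moving the minimum back to
  \<open>0\<close>. The remaining \<open>k + 1\<close> coordinates, shifted to start from index \<open>0\<close>, are scaled to the unit
  sphere, and scaling to sum \<open>1\<close> reverses this.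
\<close>

definition offset :: "nat \<Rightarrow> (nat \<Rightarrow> real) \<Rightarrow> nat \<Rightarrow> real" where
  "offset k \<alpha> = (\<lambda>i. if i \<le> k then \<alpha> (i + 1) - \<alpha> (k + 2) else 0)"

definition offset_norm :: "nat \<Rightarrow> (nat \<Rightarrow> real) \<Rightarrow> real" where
  "offset_norm k \<alpha> = sqrt (\<Sum>i\<le>k. (offset k \<alpha> i)\<^sup>2)"

definition boundary_to_sphere :: "nat \<Rightarrow> (nat \<Rightarrow> real) \<Rightarrow> nat \<Rightarrow> real" where
  "boundary_to_sphere k \<alpha> = (\<lambda>i. offset k \<alpha> i / offset_norm k \<alpha>)"

text \<open>
  The minimum includes the last coordinate, which is the value \<open>y (k + 1) = 0\<close> of a point \<open>y\<close> of the
  \<open>k\<close>-sphere.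
\<close>

definition lowest :: "nat \<Rightarrow> (nat \<Rightarrow> real) \<Rightarrow> real" where
  "lowest k y = Min ((\<lambda>x. y (x - 1)) ` {1..k+2})"

definition above_min :: "nat \<Rightarrow> (nat \<Rightarrow> real) \<Rightarrow> nat \<Rightarrow> real" where
  "above_min k y = (\<lambda>x. if x \<in> {1..k+2} then y (x - 1) - lowest k y else 0)"

definition sphere_to_boundary :: "nat \<Rightarrow> (nat \<Rightarrow> real) \<Rightarrow> nat \<Rightarrow> real" where
  "sphere_to_boundary k y = (\<lambda>x. above_min k y x / sum (above_min k y) {1..k+2})"

text \<open>
  A constant weight that vanishes somewhere is \<open>0\<close> and does not have sum \<open>1\<close>.
\<close>

lemma weights_complete_graph_not_constant:
  assumes "\<alpha> \<in> weights (nbhd_complex (complete_graph (k + 2)))"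
  shows "offset_norm k \<alpha> > 0"
proof -
  have a: "\<exists>x\<in>{1..k+2}. \<alpha> x = 0" "sum \<alpha> {1..k+2} = 1" 
    using assms unfolding weights_complete_graph by auto
  have "\<exists>i\<le>k. offset k \<alpha> i \<noteq> 0"
  proof (rule ccontr)
    assume "\<not> ?thesis"
    then have const: "\<alpha> x = \<alpha> (k + 2)" if "x \<in> {1..k+2}" for x
      using that by (cases "x = k + 2") (auto simp: offset_def dest: spec[of _ "x - 1"])
    with a(1) have "\<alpha> x = 0" if "x \<in> {1..k+2}" for x using that by metis
    with a(2) show False by simp
  qed
  then obtain i where "i \<le> k" "offset k \<alpha> i \<noteq> 0" by auto
  then have "(\<Sum>i\<le>k. (offset k \<alpha> i)\<^sup>2) > 0"
    by (intro sum_pos2[of _ i]) auto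
  then show ?thesis by (simp add: offset_norm_def)
qed

lemma above_min_nonneg: "0 \<le> above_min k y x"
proof (cases "x \<in> {1..k+2}")
  case True
  then have "lowest k y \<le> y (x - 1)" unfolding lowest_def by (intro Min_le) auto
  then show ?thesis by (simp add: above_min_def)
qed (auto simp: above_min_def)

lemma above_min_zero: "\<exists>x\<in>{1..k+2}. above_min k y x = 0"
proof -
  have "lowest k y \<in> (\<lambda>x. y (x - 1)) ` {1..k+2}"
    unfolding lowest_def by (intro Min_in) auto
  then obtain x where x: "x \<in> {1..k+2}" "lowest k y = y (x - 1)" by blast
  then have "above_min k y x = 0" unfolding above_min_def by simp
  with x show ?thesis by blast
qed

lemma offset_above_min:
  assumes "\<And>i. i > k \<Longrightarrow> y i = 0"
  shows "offset k (above_min k y) = y"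
proof
  fix i show "offset k (above_min k y) i = y i"
    using assms by (auto simp: offset_def above_min_def)
qed

lemma above_min_offset:
  assumes "\<And>x. 0 \<le> \<alpha> x" "\<And>x. x \<notin> {1..k+2} \<Longrightarrow> \<alpha> x = 0" "\<exists>x\<in>{1..k+2}. \<alpha> x = 0"
  shows "above_min k (offset k \<alpha>) = \<alpha>"
proof -
  have eq: "offset k \<alpha> (x - 1) = \<alpha> x - \<alpha> (k + 2)" if "x \<in> {1..k+2}" for x
    using that by (cases "x = k + 2") (auto simp: offset_def)
  obtain z where z: "z \<in> {1..k+2}" "\<alpha> z = 0" using assms(3) by auto
  have "lowest k (offset k \<alpha>) = - \<alpha> (k + 2)"
    unfolding lowest_def
  proof (rule Min_eqI)
    show "- \<alpha> (k + 2) \<in> (\<lambda>x. offset k \<alpha> (x - 1)) ` {1..k+2}"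
      using z eq[OF z(1)] by (intro image_eqI[of _ _ z]) simp_all
    show "- \<alpha> (k + 2) \<le> w" if "w \<in> (\<lambda>x. offset k \<alpha> (x - 1)) ` {1..k+2}" for w
      using that eq assms(1) by auto
  qed simp
  then show ?thesis
    using eq assms(2) by (auto simp: above_min_def)
qed

lemma above_min_scale:
  assumes "c > 0"
  shows "above_min k (\<lambda>i. y i / c) = (\<lambda>x. above_min k y x / c)"
proof -
  have "lowest k (\<lambda>i. y i / c) = Min ((\<lambda>r. r / c) ` (\<lambda>x. y (x - 1)) ` {1..k+2})"
    unfolding lowest_def image_image ..
  also have "\<dots> = lowest k y / c"
    unfolding lowest_def by (rule mono_Min_commute[symmetric]) (use assms in \<open>auto intro!: monoI divide_right_mono\<close>)
  finally show ?thesis by (auto simp: above_min_def diff_divide_distrib)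
qed

lemma offset_scale: "offset k (\<lambda>x. \<alpha> x / c) = (\<lambda>i. offset k \<alpha> i / c)"
  by (auto simp: offset_def diff_divide_distrib)

lemma offset_norm_scale: "c > 0 \<Longrightarrow> offset_norm k (\<lambda>x. \<alpha> x / c) = offset_norm k \<alpha> / c"
  by (simp add: offset_norm_def offset_scale power_divide real_sqrt_divide flip: sum_divide_distrib)

lemma above_min_sum_pos:
  assumes "y \<in> topspace (nsphere k)"
  shows "sum (above_min k y) {1..k+2} > 0"
proof -
  have y: "(\<Sum>i\<le>k. (y i)\<^sup>2) = 1" "\<And>i. i > k \<Longrightarrow> y i = 0" using assms by (auto simp: nsphere)
  have "sum (above_min k y) {1..k+2} \<noteq> 0"
  proof
    assume "sum (above_min k y) {1..k+2} = 0"
    then have "above_min k y x = 0" if "x \<in> {1..k+2}" for x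
      using that sum_nonneg_eq_0_iff[of "{1..k+2}" "above_min k y"] above_min_nonneg by blast
    then have "above_min k y = (\<lambda>_. 0)" by (auto simp: above_min_def)
    then have "y = (\<lambda>_. 0)" using offset_above_min[of k y, OF y(2)] by (auto simp: offset_def)
    with y(1) show False by simp
  qed
  moreover have "sum (above_min k y) {1..k+2} \<ge> 0" by (intro sum_nonneg above_min_nonneg)
  ultimately show ?thesis by linarith
qed

lemma boundary_to_sphere_in:
  assumes "\<alpha> \<in> weights (nbhd_complex (complete_graph (k + 2)))"
  shows "boundary_to_sphere k \<alpha> \<in> topspace (nsphere k)"
proof -
  have pos: "offset_norm k \<alpha> > 0" by (rule weights_complete_graph_not_constant[OF assms])
  have "(\<Sum>i\<le>k. (boundary_to_sphere k \<alpha> i)\<^sup>2) = (offset_norm k \<alpha>)\<^sup>2 / (offset_norm k \<alpha>)\<^sup>2"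
    by (simp add: boundary_to_sphere_def power_divide offset_norm_def sum_nonneg flip: sum_divide_distrib)
  with pos show ?thesis by (auto simp: nsphere boundary_to_sphere_def offset_def)
qed

lemma sphere_to_boundary_in:
  assumes "y \<in> topspace (nsphere k)"
  shows "sphere_to_boundary k y \<in> weights (nbhd_complex (complete_graph (k + 2)))"
proof -
  note pos = above_min_sum_pos[OF assms]
  have "sum (sphere_to_boundary k y) {1..k+2} = 1"
    unfolding sphere_to_boundary_def using pos by (simp flip: sum_divide_distrib)
  moreover have "\<exists>x\<in>{1..k+2}. sphere_to_boundary k y x = 0"
    using above_min_zero[of k y] by (auto simp: sphere_to_boundary_def)
  moreover have "sphere_to_boundary k y x \<ge> 0" for x
    using pos above_min_nonneg[of k y x] unfolding sphere_to_boundary_def by (intro divide_nonneg_pos)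
  moreover have "sphere_to_boundary k y x = 0" if "x \<notin> {1..k+2}" for x
    using that by (auto simp: sphere_to_boundary_def above_min_def)
  ultimately show ?thesis unfolding weights_complete_graph by blast
qed

lemma sphere_to_boundary_to_sphere:
  assumes "y \<in> topspace (nsphere k)"
  shows "boundary_to_sphere k (sphere_to_boundary k y) = y"
proof -
  have y: "(\<Sum>i\<le>k. (y i)\<^sup>2) = 1" "\<And>i. i > k \<Longrightarrow> y i = 0" using assms by (auto simp: nsphere)
  note pos = above_min_sum_pos[OF assms]
  have o: "offset k (above_min k y) = y" by (rule offset_above_min[OF y(2)])
  then have n: "offset_norm k (above_min k y) = 1" by (simp add: offset_norm_def y)
  show ?thesis
    using pos unfolding boundary_to_sphere_def sphere_to_boundary_def offset_scale offset_norm_scale[OF pos] o n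
    by simp
qed

lemma boundary_to_sphere_to_boundary:
  assumes "\<alpha> \<in> weights (nbhd_complex (complete_graph (k + 2)))"
  shows "sphere_to_boundary k (boundary_to_sphere k \<alpha>) = \<alpha>"
proof -
  have pos: "offset_norm k \<alpha> > 0" by (rule weights_complete_graph_not_constant[OF assms])
  have a: "\<And>x. 0 \<le> \<alpha> x" "\<And>x. x \<notin> {1..k+2} \<Longrightarrow> \<alpha> x = 0" "\<exists>x\<in>{1..k+2}. \<alpha> x = 0" "sum \<alpha> {1..k+2} = 1"
    using assms unfolding weights_complete_graph by auto
  have "above_min k (offset k \<alpha>) = \<alpha>" by (rule above_min_offset) (use a in auto)
  then have "above_min k (boundary_to_sphere k \<alpha>) = (\<lambda>x. \<alpha> x / offset_norm k \<alpha>)"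
    unfolding boundary_to_sphere_def above_min_scale[OF pos] by simp
  with pos a(4) show ?thesis by (simp add: sphere_to_boundary_def flip: sum_divide_distrib)
qed

lemma continuous_map_boundary_to_sphere:
  "continuous_map (geom_realization (nbhd_complex (complete_graph (k + 2)))) (nsphere k) (boundary_to_sphere k)"
proof -
  let ?X = "geom_realization (nbhd_complex (complete_graph (k + 2)))"
  have o: "continuous_map ?X euclideanreal (\<lambda>\<alpha>. offset k \<alpha> i)" for i
    by (cases "i \<le> k") (auto simp: offset_def intro!: continuous_map_diff continuous_map_coordinate)
  have n: "continuous_map ?X euclideanreal (offset_norm k)"
    unfolding offset_norm_def
    by (intro continuous_map_sqrt continuous_map_sum continuous_map_real_pow o) simp
  have "continuous_map ?X euclideanreal (\<lambda>\<alpha>. boundary_to_sphere k \<alpha> i)" for i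
    unfolding boundary_to_sphere_def
    by (intro continuous_map_real_divide o n) (use weights_complete_graph_not_constant in force)
  moreover have "boundary_to_sphere k \<in> topspace ?X \<rightarrow> {x. (\<Sum>i\<le>k. (x i)\<^sup>2) = 1 \<and> (\<forall>i>k. x i = 0)}"
    using boundary_to_sphere_in by (auto simp: nsphere)
  ultimately show ?thesis
    unfolding nsphere by (simp add: continuous_map_in_subtopology continuous_map_componentwise_UNIV)
qed

lemma continuous_map_sphere_to_boundary:
  "continuous_map (nsphere k) (geom_realization (nbhd_complex (complete_graph (k + 2)))) (sphere_to_boundary k)"
proof (rule continuous_map_into_geom_realization)
  have m: "continuous_map (nsphere k) euclideanreal (\<lambda>y. above_min k y x)" for x
    by (cases "x \<in> {1..k+2}")
       (auto simp: above_min_def lowest_def intro!: continuous_map_diff continuous_map_Min continuous_map_nsphere_projection)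
  show "continuous_map (nsphere k) euclideanreal (\<lambda>y. sphere_to_boundary k y x)" for x
    unfolding sphere_to_boundary_def
    by (intro continuous_map_real_divide continuous_map_sum m) (use above_min_sum_pos in force)+
qed (rule sphere_to_boundary_in)

text \<open>
  For \<open>m = 1\<close> the only simplex is empty, so that the realization is the empty \<open>(-1)\<close>-sphere.
\<close>

theorem complete_graph_sphere:
  assumes "1 \<le> m"
  shows "geom_realization (nbhd_complex (complete_graph m)) homotopy_equivalent_space sphere_space (int m - 2)"
proof (cases "m = 1")
  case True
  then have "weights (nbhd_complex (complete_graph m)) = {}"
    unfolding weights_complete_graph by auto
  then have "geom_realization (nbhd_complex (complete_graph m)) = trivial_topology"
    by (simp flip: null_topspace_iff_trivial)
  with True show ?thesis
    by (simp add: sphere_space_def homotopy_equivalent_space_refl)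
next
  case False
  with assms obtain k where k: "m = k + 2" by (metis One_nat_def Suc_leI add_2_eq_Suc' le_Suc_ex le_neq_implies_less numeral_2_eq_2 add.commute)
  have "homeomorphic_maps (geom_realization (nbhd_complex (complete_graph m))) (nsphere k)
      (boundary_to_sphere k) (sphere_to_boundary k)"
    unfolding homeomorphic_maps_def k
    using continuous_map_boundary_to_sphere continuous_map_sphere_to_boundary
      boundary_to_sphere_to_boundary sphere_to_boundary_to_sphere by auto
  then have "geom_realization (nbhd_complex (complete_graph m)) homeomorphic_space nsphere k"
    unfolding homeomorphic_space_def by blast
  then show ?thesis
    using homeomorphic_imp_homotopy_equivalent_space by (simp add: k sphere_space_def)
qed

section \<open>Exponential graphs over a partly looped path\<close>

lemma pair_wf_digraph_exp_graph: "pair_wf_digraph (exp_graph H G)"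
  by unfold_locales (auto simp: exp_graph_def)

lemma finite_exp_graph:
  "finite (pverts G) \<Longrightarrow> finite (pverts (exp_graph (complete_graph m) G))"
  by (simp add: exp_graph_def complete_graph_def finite_PiE)

lemma exp_complete_edge_iff:
  assumes "pair_wf_digraph G"
  shows "(f, g) \<in> parcs (exp_graph (complete_graph m) G) \<longleftrightarrow>
    f \<in> pverts G \<rightarrow>\<^sub>E {1..m} \<and> g \<in> pverts G \<rightarrow>\<^sub>E {1..m} \<and> (\<forall>(v, w) \<in> parcs G. f v \<noteq> g w)"
proof -
  have "(f v, g w) \<in> parcs (complete_graph m) \<longleftrightarrow> f v \<noteq> g w"
    if "f \<in> pverts G \<rightarrow>\<^sub>E {1..m}" "g \<in> pverts G \<rightarrow>\<^sub>E {1..m}" "(v, w) \<in> parcs G" for v w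
    using that pair_wf_digraph.in_arcsD1[OF assms that(3)] pair_wf_digraph.in_arcsD2[OF assms that(3)]
    by (auto simp: complete_graph_def PiE_iff)
  then have "(\<forall>(v, w) \<in> parcs G. (f v, g w) \<in> parcs (complete_graph m)) \<longleftrightarrow> (\<forall>(v, w) \<in> parcs G. f v \<noteq> g w)"
    if "f \<in> pverts G \<rightarrow>\<^sub>E {1..m}" "g \<in> pverts G \<rightarrow>\<^sub>E {1..m}"
    using that by blast
  then show ?thesis by (auto simp: exp_graph_def complete_graph_def)
qed

lemma looped_path_edge_iff:
  "(x, y) \<in> parcs (looped_path r {0..i}) \<longleftrightarrow> x < r \<and> y = x + 1 \<or> y < r \<and> x = y + 1 \<or> x = y \<and> x \<le> i"
  by (auto simp: looped_path_def)

lemma pverts_looped_path [simp]: "pverts (looped_path r A) = {0..r}"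
  by (simp add: looped_path_def)

lemma pair_wf_digraph_looped_path: "i < r \<Longrightarrow> pair_wf_digraph (looped_path r {0..i})"
  by unfold_locales (auto simp: looped_path_def)

text \<open>
  The result of folding away all vertices of the path above \<open>s\<close>. While \<open>s\<close> lies above the loops, the
  part above \<open>s\<close> is wound around the edge from \<open>s - 1\<close> to \<open>s\<close>; as soon as \<open>s\<close> carries a loop, that
  part is crushed to \<open>s\<close>. The two regimes fit together because the last loop is at \<open>i\<close>: consecutive
  stages are adjacent as endomorphisms of the path (\<open>path_fold_step_edge\<close>).
\<close>

definition path_fold :: "nat \<Rightarrow> nat \<Rightarrow> nat \<Rightarrow> nat" where
  "path_fold i s x = (if x \<le> s then x else if s \<le> i then s else s - (x - s) mod 2)"

lemma path_fold_below: "x \<le> s \<Longrightarrow> path_fold i s x = x"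
  by (simp add: path_fold_def)

lemma path_fold_above: "path_fold i s (s + d) = (if s \<le> i then s else s - d mod 2)"
  by (simp add: path_fold_def)

lemma path_fold_edge:
  assumes "i < r" "s \<le> r" and xy: "(x, y) \<in> parcs (looped_path r {0..i})"
  shows "(path_fold i s x, path_fold i s y) \<in> parcs (looped_path r {0..i})"
proof -
  have up: "(path_fold i s x, path_fold i s (Suc x)) \<in> parcs (looped_path r {0..i})" if "x < r" for x
  proof (cases "x < s")
    case True
    with that show ?thesis by (simp add: path_fold_below looped_path_edge_iff)
  next
    case False
    then obtain d where d: "x = s + d" by (metis le_Suc_ex not_le)
    then have "path_fold i s (Suc x) = (if s \<le> i then s else s - Suc d mod 2)"
      using path_fold_above[of i s "Suc d"] by simp
    moreover have "d mod 2 = 0 \<and> Suc d mod 2 = 1 \<or> d mod 2 = 1 \<and> Suc d mod 2 = 0" by presburger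
    ultimately show ?thesis
      using d assms(1,2) path_fold_above[of i s d] by (auto simp: looped_path_edge_iff)
  qed
  have loop: "(path_fold i s x, path_fold i s x) \<in> parcs (looped_path r {0..i})" if "x \<le> i" for x
    using that by (simp add: path_fold_def looped_path_edge_iff)
  have sym: "(b, a) \<in> parcs (looped_path r {0..i})" if "(a, b) \<in> parcs (looped_path r {0..i})" for a b
    using that by (auto simp: looped_path_edge_iff)
  from xy consider "x < r" "y = Suc x" | "y < r" "x = Suc y" | "x = y" "x \<le> i"
    by (auto simp: looped_path_edge_iff)
  then show ?thesis by cases (use up loop sym in blast)+
qed

lemma path_fold_step_edge:
  assumes "i < r" "s < r" and xy: "(x, y) \<in> parcs (looped_path r {0..i})"
  shows "(path_fold i s x, path_fold i (Suc s) y) \<in> parcs (looped_path r {0..i})"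
proof -
  have above: "((if s \<le> i then s else s - d mod 2), path_fold i (Suc s) (Suc s + d))
      \<in> parcs (looped_path r {0..i})" for d
  proof -
    have "d mod 2 = 0 \<or> d mod 2 = 1" by presburger
    then show ?thesis
      using assms(1,2) unfolding path_fold_above by (auto simp: looped_path_edge_iff)
  qed
  from xy consider "x < r" "y = Suc x" | "y < r" "x = Suc y" | "x = y" "x \<le> i"
    by (auto simp: looped_path_edge_iff)
  then show ?thesis
  proof cases
    case 1
    show ?thesis
    proof (cases "x < s")
      case True
      with xy 1 show ?thesis by (simp add: path_fold_below)
    next
      case False
      then obtain d where "x = s + d" by (metis le_Suc_ex not_le)
      with 1 above[of d] show ?thesis by (simp add: path_fold_above)
    qed
  next
    case 2
    consider "y < s" | "y = s" | d where "y = Suc s + d"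
      by (metis le_Suc_ex linorder_neqE_nat Suc_leI)
    then show ?thesis
    proof cases
      case 1
      with xy 2 show ?thesis by (simp add: path_fold_below)
    next
      case y: 2
      then show ?thesis
        using assms(1,2) 2 path_fold_above[of i s 1] by (auto simp: path_fold_below looped_path_edge_iff)
    next
      case (3 d)
      then have "x = s + (d + 2)" using 2 by simp
      then have "path_fold i s x = (if s \<le> i then s else s - d mod 2)"
        using path_fold_above[of i s "d + 2"] by simp
      with above[of d] 3 show ?thesis by simp
    qed
  next
    case 3
    show ?thesis
    proof (cases "x \<le> s")
      case True
      with xy 3 show ?thesis by (simp add: path_fold_below)
    next
      case False
      with 3 assms show ?thesis by (simp add: path_fold_def looped_path_edge_iff)
    qed
  qed
qed

lemma path_fold_le: "s \<le> r \<Longrightarrow> x \<le> r \<Longrightarrow> path_fold i s x \<le> r"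
  unfolding path_fold_def by auto

text \<open>
  Precomposition with the stages of the folding is a chain of adjacent endomorphisms of the
  exponential graph. It joins the identity to \<open>f \<mapsto> f 0\<close>, read as a constant map. The loop at \<open>0\<close> makes
  evaluation at \<open>0\<close> a homomorphism.
\<close>

lemma nbhd_complex_exp_looped_path:
  assumes "i < r"
  shows "geom_realization (nbhd_complex (exp_graph (complete_graph m) (looped_path r {0..i})))
    homotopy_equivalent_space geom_realization (nbhd_complex (complete_graph m))"
proof -
  let ?L = "looped_path r {0..i}"
  let ?H = "exp_graph (complete_graph m) ?L"
  note edge = exp_complete_edge_iff[OF pair_wf_digraph_looped_path[OF assms], of _ _ m]
  define pull where "pull s f = (\<lambda>x\<in>{0..r}. f (path_fold i s x))" for s and f :: "nat \<Rightarrow> nat"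
  define const where "const c = (\<lambda>x\<in>{0..r}. c)" for c :: nat
  have pull_edge: "(pull s f, pull t g) \<in> parcs ?H"
    if fg: "(f, g) \<in> parcs ?H" and st: "s \<le> r" "t \<le> r"
      and fold: "\<And>x y. (x, y) \<in> parcs ?L \<Longrightarrow> (path_fold i s x, path_fold i t y) \<in> parcs ?L"
    for s t f g
  proof -
    have "pull s f x \<noteq> pull t g y" if xy: "(x, y) \<in> parcs ?L" for x y
    proof -
      have "x \<le> r" "y \<le> r" using xy assms by (auto simp: looped_path_edge_iff)
      then show ?thesis using fg fold[OF xy] by (auto simp: edge pull_def)
    qed
    moreover have "pull s f \<in> {0..r} \<rightarrow>\<^sub>E {1..m}" "pull t g \<in> {0..r} \<rightarrow>\<^sub>E {1..m}"
      using fg path_fold_le[OF st(1)] path_fold_le[OF st(2)] by (auto simp: edge pull_def)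
    ultimately show ?thesis by (auto simp: edge)
  qed
  have pull_step: "times_adjacent ?H ?H (pull s) (pull (Suc s))" if "s < r" for s
    unfolding times_adjacent_def
  proof clarify
    fix f g assume fg: "(f, g) \<in> parcs ?H"
    show "(pull s f, pull s g) \<in> parcs ?H \<and> (pull (Suc s) f, pull (Suc s) g) \<in> parcs ?H \<and>
        (pull s f, pull (Suc s) g) \<in> parcs ?H"
      by (intro conjI pull_edge[OF fg] path_fold_edge[OF assms] path_fold_step_edge[OF assms])
         (use that in simp_all)
  qed
  have pull_r: "pull r f = f" if "f \<in> {0..r} \<rightarrow>\<^sub>E {1..m}" for f
    using that by (auto simp: pull_def path_fold_def PiE_iff extensional_def)
  have chain: "(times_adjacent ?H ?H)\<^sup>*\<^sup>* (pull s) id" if "s \<le> r" for s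
    using that
  proof (induction rule: inc_induct)
    case base
    have "pull r f = f \<and> pull r g = g" if "(f, g) \<in> parcs ?H" for f g
      using that pull_r by (simp add: edge)
    then have "times_adjacent ?H ?H (pull r) id" by (fastforce simp: times_adjacent_def)
    then show ?case by blast
  next
    case (step s)
    with pull_step show ?case
      by (meson converse_rtranclp_into_rtranclp)
  qed
  show ?thesis
  proof (rule homotopy_equivalent_nbhd_complexes[where \<phi> = "\<lambda>f. f 0" and \<psi> = const])
    show "times_adjacent ?H (complete_graph m) (\<lambda>f. f 0) (\<lambda>f. f 0)"
    proof -
      have "(f 0, g 0) \<in> parcs (complete_graph m)" if "(f, g) \<in> parcs ?H" for f g
      proof -
        have "(0, 0) \<in> parcs ?L" by (simp add: looped_path_edge_iff)
        with that have "f 0 \<noteq> g 0" "f 0 \<in> {1..m}" "g 0 \<in> {1..m}" unfolding edge by auto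
        then show ?thesis by (simp add: complete_graph_def)
      qed
      then show ?thesis by (auto simp: times_adjacent_def)
    qed
    show "times_adjacent (complete_graph m) ?H const const"
    proof -
      have "(const c, const d) \<in> parcs ?H" if cd: "(c, d) \<in> parcs (complete_graph m)" for c d
      proof -
        have "const c x \<noteq> const d y" if "(x, y) \<in> parcs ?L" for x y
          using that cd assms by (auto simp: const_def looped_path_edge_iff complete_graph_def)
        moreover have "const e \<in> {0..r} \<rightarrow>\<^sub>E {1..m}" if "e \<in> {1..m}" for e
          using that by (auto simp: const_def)
        moreover have "c \<in> {1..m}" "d \<in> {1..m}" using cd by (auto simp: complete_graph_def)
        ultimately show ?thesis unfolding edge pverts_looped_path by blast
      qed
      then show ?thesis by (auto simp: times_adjacent_def)
    qed
    have "path_fold i 0 x = 0" for x by (simp add: path_fold_def)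
    then have "const \<circ> (\<lambda>f. f 0) = pull 0" by (intro ext) (simp add: const_def pull_def)
    then show "(times_adjacent ?H ?H)\<^sup>*\<^sup>* (const \<circ> (\<lambda>f. f 0)) id" using chain[of 0] by simp
    have "(\<lambda>f. f 0) \<circ> const = id" by (intro ext) (simp add: const_def)
    then show "(times_adjacent (complete_graph m) (complete_graph m))\<^sup>*\<^sup>* ((\<lambda>f. f 0) \<circ> const) id" by simp
    show "finite (pverts (complete_graph m))" by (simp add: complete_graph_def)
  qed (simp_all add: pair_wf_digraph_exp_graph pair_wf_digraph_complete_graph finite_exp_graph)
qed

section \<open>Vertices and edges of the cone\<close>

text \<open>
  The equivalence class of \<open>(v, j)\<close>; the apex is \<open>cone_vertex T r v r\<close> for every \<open>v\<close>.
\<close>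

definition cone_vertex :: "'a pair_pre_digraph \<Rightarrow> nat \<Rightarrow> 'a \<Rightarrow> nat \<Rightarrow> ('a \<times> nat) set" where
  "cone_vertex T r v j = (if j = r then pverts T \<times> {r} else {(v, j)})"

definition level :: "('a \<times> nat) set \<Rightarrow> nat" where
  "level X = snd (SOME p. p \<in> X)"

lemma level_cone_vertex [simp]:
  assumes "v \<in> pverts T"
  shows "level (cone_vertex T r v j) = j"
proof -
  have "(SOME p. p \<in> cone_vertex T r v j) \<in> cone_vertex T r v j"
    by (rule someI[of _ "(v, j)"]) (use assms in \<open>auto simp: cone_vertex_def\<close>)
  then show ?thesis by (auto simp: level_def cone_vertex_def split: if_splits)
qed

lemma cone_vertex_top: "cone_vertex T r v r = cone_vertex T r w r"
  by (simp add: cone_vertex_def)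

lemma collapse_top_class:
  assumes "v \<in> pverts T" "j \<le> r"
  shows "collapse_top (pverts T \<times> {0..r}) r `` {(v, j)} = cone_vertex T r v j"
  using assms by (auto simp: collapse_top_def cone_vertex_def)

lemma pverts_cat_prod_path [simp]: "pverts (cat_prod T (looped_path r A)) = pverts T \<times> {0..r}"
  by (simp add: cat_prod_def)

lemma pverts_gen_cone: "pverts (gen_cone T r A) = {cone_vertex T r v j | v j. v \<in> pverts T \<and> j \<le> r}"
proof -
  have "pverts (gen_cone T r A) = (\<Union>(v, j)\<in>pverts T \<times> {0..r}. {collapse_top (pverts T \<times> {0..r}) r `` {(v, j)}})"
    by (auto simp: gen_cone_def quotient_graph_def quotient_def)
  also have "\<dots> = {cone_vertex T r v j | v j. v \<in> pverts T \<and> j \<le> r}"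
    using collapse_top_class by fastforce
  finally show ?thesis .
qed

lemma in_cone_vertex:
  assumes "(w, k) \<in> cone_vertex T r v j"
  shows "cone_vertex T r w k = cone_vertex T r v j"
  using assms by (auto simp: cone_vertex_def split: if_splits)

lemma gen_cone_edge_iff:
  assumes "pair_wf_digraph T" "i < r"
  shows "(X, Y) \<in> parcs (gen_cone T r {0..i}) \<longleftrightarrow>
    (\<exists>v w j k. (v, w) \<in> parcs T \<and> (j, k) \<in> parcs (looped_path r {0..i}) \<and>
       X = cone_vertex T r v j \<and> Y = cone_vertex T r w k)" (is "?l \<longleftrightarrow> ?r")
proof
  have edge: "((v, j), (w, k)) \<in> parcs (cat_prod T (looped_path r {0..i})) \<longleftrightarrow>
      (v, w) \<in> parcs T \<and> (j, k) \<in> parcs (looped_path r {0..i})" for v j w k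
    by (simp add: cat_prod_def)
  have arcs: "parcs (gen_cone T r {0..i}) = {(X, Y). X \<in> pverts (gen_cone T r {0..i}) \<and>
      Y \<in> pverts (gen_cone T r {0..i}) \<and>
      (\<exists>x\<in>X. \<exists>y\<in>Y. (x, y) \<in> parcs (cat_prod T (looped_path r {0..i})))}"
    by (simp add: gen_cone_def quotient_graph_def Let_def)
  {
    assume ?l
    then obtain v j w k where XY: "X \<in> pverts (gen_cone T r {0..i})" "Y \<in> pverts (gen_cone T r {0..i})"
      "(v, j) \<in> X" "(w, k) \<in> Y" and e: "(v, w) \<in> parcs T" "(j, k) \<in> parcs (looped_path r {0..i})"
      unfolding arcs using edge by fastforce
    then have "X = cone_vertex T r v j" "Y = cone_vertex T r w k"
      unfolding pverts_gen_cone using in_cone_vertex by fastforce+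
    with e show ?r by blast
  next
    assume ?r
    then obtain v w j k where e: "(v, w) \<in> parcs T" "(j, k) \<in> parcs (looped_path r {0..i})"
      and XY: "X = cone_vertex T r v j" "Y = cone_vertex T r w k" by blast
    have "v \<in> pverts T" "w \<in> pverts T"
      using e(1) pair_wf_digraph.in_arcsD1[OF assms(1)] pair_wf_digraph.in_arcsD2[OF assms(1)] by auto
    moreover have "j \<le> r" "k \<le> r" using e(2) assms(2) by (auto simp: looped_path_edge_iff)
    moreover have "(v, j) \<in> X" "(w, k) \<in> Y"
      using calculation XY by (auto simp: cone_vertex_def)
    ultimately show ?l
      unfolding arcs pverts_gen_cone using e XY edge by blast
  }
qed

section \<open>Flattening the levels of the cone\<close>

text \<open>
  Domination of all vertices by each edge stands for property P together with connectedness, and the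
  bound on the chromatic number takes the form of non-colorability with fewer than \<open>m\<close> colors. Both
  are immediate for complete graphs.
\<close>

locale coned_coloring =
  fixes T :: "'a pair_pre_digraph" and m r i :: nat
  assumes wf: "pair_wf_digraph T" and finite_verts: "finite (pverts T)"
    and sym: "\<And>v w. (v, w) \<in> parcs T \<Longrightarrow> (w, v) \<in> parcs T"
    and arcs_nonempty: "parcs T \<noteq> {}"
    and dominating: "\<And>a b v. (a, b) \<in> parcs T \<Longrightarrow> v \<in> pverts T \<Longrightarrow> (v, a) \<in> parcs T \<or> (v, b) \<in> parcs T"
    and not_colorable: "\<And>k f. k < m \<Longrightarrow> \<not> graph_hom T (complete_graph k) f"
    and i_less: "i < r"
begin

abbreviation "V \<equiv> pverts T"
abbreviation "E \<equiv> parcs T"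
abbreviation "L \<equiv> looped_path r {0..i}"
abbreviation "G \<equiv> gen_cone T r {0..i}"
abbreviation "H \<equiv> exp_graph (complete_graph m) G"
abbreviation "c \<equiv> cone_vertex T r"

lemmas path_edge = looped_path_edge_iff[of _ _ r i]

lemma E_verts: "(v, w) \<in> E \<Longrightarrow> v \<in> V" "(v, w) \<in> E \<Longrightarrow> w \<in> V"
  using pair_wf_digraph.in_arcsD1[OF wf] pair_wf_digraph.in_arcsD2[OF wf] by auto

lemma has_neighbour: "v \<in> V \<Longrightarrow> \<exists>w. (v, w) \<in> E"
  using arcs_nonempty dominating by (metis equals0I surj_pair)

lemma pair_wf_digraph_cone: "pair_wf_digraph G"
  by unfold_locales (auto simp: gen_cone_def quotient_graph_def Let_def)

lemma finite_cone: "finite (pverts G)"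
proof -
  have "pverts G = (\<lambda>(v, j). c v j) ` (V \<times> {0..r})" by (force simp: pverts_gen_cone)
  then show ?thesis using finite_verts by simp
qed

lemma cone_vertex_in: "v \<in> V \<Longrightarrow> j \<le> r \<Longrightarrow> c v j \<in> pverts G"
  by (auto simp: pverts_gen_cone)

lemma H_edge_iff:
  "(f, g) \<in> parcs H \<longleftrightarrow> f \<in> pverts G \<rightarrow>\<^sub>E {1..m} \<and> g \<in> pverts G \<rightarrow>\<^sub>E {1..m} \<and>
     (\<forall>v w j k. (v, w) \<in> E \<longrightarrow> (j, k) \<in> parcs L \<longrightarrow> f (c v j) \<noteq> g (c w k))"
proof -
  have "(\<forall>(X, Y) \<in> parcs G. f X \<noteq> g Y) \<longleftrightarrow>
      (\<forall>X Y. (\<exists>v w j k. (v, w) \<in> E \<and> (j, k) \<in> parcs L \<and> X = c v j \<and> Y = c w k) \<longrightarrow> f X \<noteq> g Y)"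
    by (simp only: Ball_def split_paired_All prod.case gen_cone_edge_iff[OF wf i_less])
  also have "\<dots> \<longleftrightarrow> (\<forall>v w j k. (v, w) \<in> E \<longrightarrow> (j, k) \<in> parcs L \<longrightarrow> f (c v j) \<noteq> g (c w k))" by metis
  finally show ?thesis unfolding exp_complete_edge_iff[OF pair_wf_digraph_cone] by (simp only:)
qed

lemma H_edgeI:
  assumes "f \<in> pverts G \<rightarrow>\<^sub>E {1..m}" "g \<in> pverts G \<rightarrow>\<^sub>E {1..m}"
    and "\<And>v w j k. (v, w) \<in> E \<Longrightarrow> (j, k) \<in> parcs L \<Longrightarrow> f (c v j) \<noteq> g (c w k)"
  shows "(f, g) \<in> parcs H"
  using assms unfolding H_edge_iff by simp

lemma H_edge_coloring: "(f, g) \<in> parcs H \<Longrightarrow> f \<in> pverts G \<rightarrow>\<^sub>E {1..m}"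
  unfolding H_edge_iff by (rule conjunct1)

lemma H_edge_neq:
  "(f, g) \<in> parcs H \<Longrightarrow> (v, w) \<in> E \<Longrightarrow> (j, k) \<in> parcs L \<Longrightarrow> f (c v j) \<noteq> g (c w k)"
  by (simp add: H_edge_iff)

lemma H_edge_color: "(f, g) \<in> parcs H \<Longrightarrow> v \<in> V \<Longrightarrow> j \<le> r \<Longrightarrow> f (c v j) \<in> {1..m}"
  by (rule PiE_mem[OF H_edge_coloring cone_vertex_in])

lemma path_sym: "(j, k) \<in> parcs L \<Longrightarrow> (k, j) \<in> parcs L"
  by (auto simp: path_edge)

lemma H_edge_sym:
  assumes "(f, g) \<in> parcs H"
  shows "(g, f) \<in> parcs H"
proof -
  have "g (c v j) \<noteq> f (c w k)" if "(v, w) \<in> E" "(j, k) \<in> parcs L" for v w j k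
    using H_edge_neq[OF assms sym[OF that(1)] path_sym[OF that(2)]] by simp
  with assms show ?thesis unfolding H_edge_iff by simp
qed

lemma card_remove_color: "d \<in> {1..m} \<Longrightarrow> card ({1..m} - {d}) < m"
  by (cases m) auto

lemma monochromatic_edge:
  assumes "h \<in> V \<rightarrow> S" "finite S" "card S < m"
  shows "\<exists>a b. (a, b) \<in> E \<and> h a = h b"
proof -
  obtain g where g: "bij_betw g S {1..card S}"
    using assms(2) finite_same_card_bij[of S "{1..card S}"] by auto
  have "\<not> graph_hom T (complete_graph (card S)) (g \<circ> h)" using assms(3) by (rule not_colorable)
  moreover have in_S: "h v \<in> S" "g (h v) \<in> {1..card S}" if "v \<in> V" for v
    using that assms(1) bij_betwE[OF g] by blast+
  ultimately obtain a b where ab: "(a, b) \<in> E" "(g (h a), g (h b)) \<notin> parcs (complete_graph (card S))"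
    unfolding graph_hom_def by (auto simp: complete_graph_def)
  then have "a \<in> V" "b \<in> V" using E_verts by auto
  with ab in_S have "g (h a) = g (h b)" by (auto simp: complete_graph_def)
  then have "h a = h b"
    using bij_betw_imp_inj_on[OF g] in_S(1)[OF \<open>a \<in> V\<close>] in_S(1)[OF \<open>b \<in> V\<close>] by (simp add: inj_on_eq_iff)
  with ab show ?thesis by blast
qed

text \<open>
  If \<open>w\<close> had the color \<open>h' w \<noteq> h w\<close>, then no vertex of either of these two \<open>h\<close>-colors would be
  adjacent to \<open>w\<close>. Since edges dominate, no edge joins two such vertices, so the two color classes
  could be merged, which would leave a proper coloring with \<open>m - 1\<close> colors.
\<close>

lemma proper_coloring_rigid:
  assumes h: "h \<in> V \<rightarrow> {1..m}" and proper: "\<And>v w. (v, w) \<in> E \<Longrightarrow> h v \<noteq> h w"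
    and h': "h' \<in> V \<rightarrow> {1..m}" and adj: "\<And>v w. (v, w) \<in> E \<Longrightarrow> h v \<noteq> h' w"
    and w: "w \<in> V"
  shows "h' w = h w"
proof (rule ccontr)
  assume ne: "h' w \<noteq> h w"
  define merged where "merged u = (if h u = h' w then h w else h u)" for u
  have nonadj: "(u, w) \<notin> E" if "h u = h w \<or> h u = h' w" for u
    using that proper adj by metis
  have "h u \<in> {1..m}" if "u \<in> V" for u using h that by blast
  then have "merged u \<in> {1..m} - {h' w}" if "u \<in> V" for u
    using that w ne unfolding merged_def by (cases "h u = h' w") simp_all
  then have "merged \<in> V \<rightarrow> {1..m} - {h' w}" by blast
  moreover have "h' w \<in> {1..m}" using h' w by blast
  then have "card ({1..m} - {h' w}) < m" by (rule card_remove_color)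
  ultimately obtain a b where ab: "(a, b) \<in> E" "merged a = merged b"
    using monochromatic_edge[of merged "{1..m} - {h' w}"] by blast
  with proper[OF ab(1)] have "h a = h w \<or> h a = h' w" "h b = h w \<or> h b = h' w"
    by (auto simp: merged_def split: if_splits)
  with nonadj dominating[OF ab(1) w] show False using sym by blast
qed

text \<open>
  By rigidity a proper coloring at the bottom would be copied by \<open>f\<close> and \<open>g\<close> to all levels. At the
  bottom the copying from \<open>f\<close> to \<open>g\<close> uses the loop at \<open>0\<close>. At the apex all vertices of \<open>T\<close> coincide,
  so that the two ends of an edge would get the same color.
\<close>

lemma bottom_monochromatic_edge:
  assumes fg: "(f, g) \<in> parcs H"
  shows "\<exists>a b. (a, b) \<in> E \<and> f (c a 0) = f (c b 0)"
proof (rule ccontr)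
  assume "\<not> ?thesis"
  then have proper: "f (c a 0) \<noteq> f (c b 0)" if "(a, b) \<in> E" for a b using that by blast
  note gf = H_edge_sym[OF fg]
  have col: "(\<lambda>v. f (c v j)) \<in> V \<rightarrow> {1..m}" "(\<lambda>v. g (c v j)) \<in> V \<rightarrow> {1..m}" if "j \<le> r" for j
    using that H_edge_color[OF fg] H_edge_color[OF gf] by blast+
  have "f (c v j) = f (c v 0) \<and> g (c v j) = f (c v 0)" if "j \<le> r" "v \<in> V" for j v
    using that
  proof (induction j arbitrary: v)
    case 0
    have "(0, 0) \<in> parcs L" by (simp add: path_edge)
    then have "g (c v 0) = f (c v 0)"
      by (intro proper_coloring_rigid[OF col(1)[of 0] proper col(2)[of 0]]) (use 0 H_edge_neq[OF fg] in auto)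
    then show ?case by simp
  next
    case (Suc j)
    have e: "(j, Suc j) \<in> parcs L" using Suc.prems by (simp add: path_edge)
    have "f (c w (Suc j)) \<noteq> f (c v 0)" "g (c w (Suc j)) \<noteq> f (c v 0)" if "(v, w) \<in> E" for v w
      using that H_edge_neq[OF fg that e] H_edge_neq[OF gf that e] Suc E_verts(1)[OF that] by auto
    note ne = this[symmetric]
    have "f (c v (Suc j)) = f (c v 0)"
      by (rule proper_coloring_rigid[OF col(1)[of 0] proper col(1)[OF Suc.prems(1)] ne(1) Suc.prems(2)]) auto
    moreover have "g (c v (Suc j)) = f (c v 0)"
      by (rule proper_coloring_rigid[OF col(1)[of 0] proper col(2)[OF Suc.prems(1)] ne(2) Suc.prems(2)]) auto
    ultimately show ?case by simp
  qed
  then have top: "f (c v r) = f (c v 0)" if "v \<in> V" for v using that by blast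
  obtain a b where ab: "(a, b) \<in> E" using arcs_nonempty by auto
  have "f (c a 0) = f (c b 0)"
    using top[OF E_verts(1)[OF ab]] top[OF E_verts(2)[OF ab]] cone_vertex_top[of T r a b] by simp
  with proper[OF ab] show False by blast
qed

definition flat_below :: "nat \<Rightarrow> (('a \<times> nat) set \<Rightarrow> nat) \<Rightarrow> bool" where
  "flat_below j f \<longleftrightarrow> (\<forall>k<j. \<forall>v\<in>V. \<forall>w\<in>V. f (c v k) = f (c w k))"

text \<open>
  Above the bottom, \<open>f\<close> misses the one color that \<open>g\<close> has on the level below: every vertex of level
  \<open>j\<close> has a neighbor there.
\<close>

lemma level_monochromatic_edge:
  assumes fg: "(f, g) \<in> parcs H" and flat: "flat_below j g" and j: "j < r"
  shows "\<exists>a b. (a, b) \<in> E \<and> f (c a j) = f (c b j)"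
proof (cases j)
  case 0
  with bottom_monochromatic_edge[OF fg] show ?thesis by simp
next
  case (Suc k)
  obtain v0 where v0: "v0 \<in> V" using arcs_nonempty E_verts by auto
  have e: "(j, k) \<in> parcs L" using Suc j by (simp add: path_edge)
  have "f (c v j) \<noteq> g (c v0 k)" if v: "v \<in> V" for v
  proof -
    obtain w where "(v, w) \<in> E" using has_neighbour[OF v] by blast
    then have "f (c v j) \<noteq> g (c w k)" "w \<in> V" using H_edge_neq[OF fg _ e] E_verts(2) by auto
    moreover have "g (c w k) = g (c v0 k)"
      using flat \<open>w \<in> V\<close> v0 Suc unfolding flat_below_def by blast
    ultimately show ?thesis by simp
  qed
  then have "(\<lambda>v. f (c v j)) \<in> V \<rightarrow> {1..m} - {g (c v0 k)}"
    using H_edge_color[OF fg] less_imp_le[OF j] by blast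
  moreover have "g (c v0 k) \<in> {1..m}" using H_edge_color[OF H_edge_sym[OF fg] v0] Suc j by simp
  then have "card ({1..m} - {g (c v0 k)}) < m" by (rule card_remove_color)
  ultimately show ?thesis
    using monochromatic_edge[of "\<lambda>v. f (c v j)" "{1..m} - {g (c v0 k)}"] by blast
qed

text \<open>
  Level \<open>j\<close> gets the color of a monochromatic edge of \<open>f\<close> at that level. Where there is none the
  choice is arbitrary; a map with a neighbor that is flat below \<open>j\<close> is never of this kind
  (\<open>level_monochromatic_edge\<close>).
\<close>

definition flatten :: "nat \<Rightarrow> (('a \<times> nat) set \<Rightarrow> nat) \<Rightarrow> ('a \<times> nat) set \<Rightarrow> nat" where
  "flatten j f = (\<lambda>X\<in>pverts G. if level X = j
      then SOME d. \<exists>a b. (a, b) \<in> E \<and> f (c a j) = d \<and> f (c b j) = d else f X)"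

lemma flatten_other: "v \<in> V \<Longrightarrow> k \<le> r \<Longrightarrow> k \<noteq> j \<Longrightarrow> flatten j f (c v k) = f (c v k)"
  by (simp add: flatten_def cone_vertex_in)

lemma flatten_at:
  assumes "\<exists>a b. (a, b) \<in> E \<and> f (c a j) = f (c b j)" "j \<le> r"
  obtains a b where "(a, b) \<in> E" "f (c a j) = f (c b j)" "\<And>v. v \<in> V \<Longrightarrow> flatten j f (c v j) = f (c a j)"
proof -
  obtain a0 b0 where "(a0, b0) \<in> E" "f (c a0 j) = f (c b0 j)" using assms(1) by blast
  then have "\<exists>d a b. (a, b) \<in> E \<and> f (c a j) = d \<and> f (c b j) = d"
    by (intro exI[of _ "f (c a0 j)"] exI[of _ a0] exI[of _ b0]) simp
  from someI_ex[OF this] obtain a b where ab: "(a, b) \<in> E"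
      "f (c a j) = (SOME d. \<exists>a b. (a, b) \<in> E \<and> f (c a j) = d \<and> f (c b j) = d)"
      "f (c b j) = (SOME d. \<exists>a b. (a, b) \<in> E \<and> f (c a j) = d \<and> f (c b j) = d)"
    by blast
  show ?thesis
  proof (rule that[OF ab(1)])
    show "f (c a j) = f (c b j)" unfolding ab(2,3) ..
    show "flatten j f (c v j) = f (c a j)" if "v \<in> V" for v
      unfolding ab(2) flatten_def using that cone_vertex_in[OF that assms(2)] by (simp only: restrict_apply level_cone_vertex refl if_True)
  qed
qed

lemma flat_below_flatten:
  assumes "flat_below j f" "j \<le> r"
  shows "flat_below (Suc j) (flatten j f)"
  unfolding flat_below_def
proof (intro allI impI ballI)
  fix k v w assume k: "k < Suc j" and vw: "v \<in> V" "w \<in> V"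
  show "flatten j f (c v k) = flatten j f (c w k)"
  proof (cases "k = j")
    case True
    have "c v j \<in> pverts G" "c w j \<in> pverts G" "level (c v j) = j" "level (c w j) = j"
      using vw assms(2) by (simp_all add: cone_vertex_in)
    with True show ?thesis by (simp only: flatten_def restrict_apply if_True refl)
  next
    case False
    with k assms(2) have "k < j" "k \<le> r" by simp_all
    moreover from this vw assms(1) have "f (c v k) = f (c w k)" unfolding flat_below_def by blast
    ultimately show ?thesis using vw False by (simp add: flatten_other)
  qed
qed

text \<open>
  This is the folding step. Every vertex of \<open>T\<close> is adjacent to an end of the monochromatic edge, and
  adjacency in the cone depends on the levels and on adjacency in \<open>T\<close> only. So a vertex of the cone
  that has a neighbor at level \<open>j\<close> is adjacent to an end of that edge, and \<open>g\<close> avoids its color there.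
\<close>

lemma flatten_edge:
  assumes fg: "(f, g) \<in> parcs H" and flat: "flat_below j g" and j: "j < r"
  shows "(flatten j f, g) \<in> parcs H"
proof -
  obtain a b where ab: "(a, b) \<in> E" "f (c a j) = f (c b j)"
    and at: "\<And>v. v \<in> V \<Longrightarrow> flatten j f (c v j) = f (c a j)"
    by (rule flatten_at[OF level_monochromatic_edge[OF assms] less_imp_le[OF j]]) blast
  have neq: "flatten j f (c v k) \<noteq> g (c w l)" if vw: "(v, w) \<in> E" and kl: "(k, l) \<in> parcs L" for v w k l
  proof (cases "k = j")
    case True
    have "(a, w) \<in> E \<or> (b, w) \<in> E" using dominating[OF ab(1), of w] E_verts(2)[OF vw] sym by blast
    then have "f (c a j) \<noteq> g (c w l)"
    proof
      assume "(a, w) \<in> E"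
      from H_edge_neq[OF fg this kl] show ?thesis using True by simp
    next
      assume "(b, w) \<in> E"
      from H_edge_neq[OF fg this kl] show ?thesis using True ab(2) by simp
    qed
    then show ?thesis using at E_verts(1)[OF vw] True by simp
  next
    case False
    have "k \<le> r" using kl i_less by (auto simp: path_edge)
    with False H_edge_neq[OF fg vw kl] E_verts(1)[OF vw] show ?thesis by (simp add: flatten_other)
  qed
  have color: "flatten j f X \<in> {1..m}" if X: "X \<in> pverts G" for X
  proof -
    obtain v k where v: "X = c v k" "v \<in> V" "k \<le> r" using X by (auto simp: pverts_gen_cone)
    show ?thesis
    proof (cases "k = j")
      case True
      then have "flatten j f X = f (c a j)" using v at by simp
      then show ?thesis using H_edge_color[OF fg E_verts(1)[OF ab(1)] less_imp_le[OF j]] by simp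
    next
      case False
      then have "flatten j f X = f (c v k)" using v by (simp add: flatten_other)
      then show ?thesis using H_edge_color[OF fg v(2,3)] by simp
    qed
  qed
  have "flatten j f \<in> pverts G \<rightarrow>\<^sub>E {1..m}"
  proof (rule PiE_I)
    show "flatten j f X = undefined" if "X \<notin> pverts G" for X
      using that by (simp only: flatten_def restrict_apply if_False)
  qed (rule color)
  then show ?thesis
  proof (rule H_edgeI)
    show "g \<in> pverts G \<rightarrow>\<^sub>E {1..m}" by (rule H_edge_coloring[OF H_edge_sym[OF fg]])
  qed (rule neq)
qed

fun flatten_below :: "nat \<Rightarrow> (('a \<times> nat) set \<Rightarrow> nat) \<Rightarrow> ('a \<times> nat) set \<Rightarrow> nat" where
  "flatten_below 0 f = f"
| "flatten_below (Suc j) f = flatten j (flatten_below j f)"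

text \<open>
  The flatness of both ends of the edge is carried through the induction, because flattening level
  \<open>j\<close> of one end needs the flatness of the other end below \<open>j\<close>.
\<close>

lemma flatten_below_edge:
  assumes "(f, g) \<in> parcs H" "j \<le> r"
  shows "(flatten_below j f, flatten_below j g) \<in> parcs H \<and>
    flat_below j (flatten_below j f) \<and> flat_below j (flatten_below j g)"
  using assms(2)
proof (induction j)
  case 0
  with assms show ?case by (simp add: flat_below_def)
next
  case (Suc j)
  then have IH: "(flatten_below j f, flatten_below j g) \<in> parcs H"
      "flat_below j (flatten_below j f)" "flat_below j (flatten_below j g)" and j: "j < r"
    by simp_all
  have 1: "(flatten_below j g, flatten j (flatten_below j f)) \<in> parcs H"
    by (rule H_edge_sym[OF flatten_edge[OF IH(1,3) j]])
  have flat: "flat_below (Suc j) (flatten j (flatten_below j f))"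
      "flat_below (Suc j) (flatten j (flatten_below j g))"
    using flat_below_flatten[OF IH(2)] flat_below_flatten[OF IH(3)] j by simp_all
  then have "flat_below j (flatten j (flatten_below j f))"
    unfolding flat_below_def by (meson less_SucI)
  \<comment> \<open>The second end is flattened against the first one, which is flat already.\<close>
  from H_edge_sym[OF flatten_edge[OF 1 this j]] flat show ?case
    unfolding flatten_below.simps by blast
qed

lemma flatten_below_step:
  assumes "j < r"
  shows "times_adjacent H H (flatten_below (Suc j)) (flatten_below j)"
  unfolding times_adjacent_def
proof clarify
  fix f g assume fg: "(f, g) \<in> parcs H"
  note now = flatten_below_edge[OF fg less_imp_le[OF assms]]
  have "(flatten_below (Suc j) f, flatten_below j g) \<in> parcs H"
    unfolding flatten_below.simps using now assms by (intro flatten_edge) blast+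
  with now flatten_below_edge[OF fg Suc_leI[OF assms]] show "(flatten_below (Suc j) f, flatten_below (Suc j) g) \<in> parcs H \<and>
      (flatten_below j f, flatten_below j g) \<in> parcs H \<and>
      (flatten_below (Suc j) f, flatten_below j g) \<in> parcs H" by blast
qed

lemma flatten_below_chain:
  "j \<le> r \<Longrightarrow> (times_adjacent H H)\<^sup>*\<^sup>* (flatten_below j) id"
proof (induction j)
  case 0
  have "flatten_below 0 = id" by (intro ext) simp
  then show ?case by simp
next
  case (Suc j)
  then have "j < r" by simp
  have IH: "(times_adjacent H H)\<^sup>*\<^sup>* (flatten_below j) id" by (rule Suc.IH[OF Suc_leD[OF Suc.prems]])
  from \<open>j < r\<close> show ?case by (intro converse_rtranclp_into_rtranclp[OF flatten_below_step IH])
qed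

text \<open>
  Precomposition with the projection of the cone onto the path.
\<close>

definition lift :: "(nat \<Rightarrow> nat) \<Rightarrow> ('a \<times> nat) set \<Rightarrow> nat" where
  "lift u = (\<lambda>X\<in>pverts G. u (level X))"

lemma lift_at: "v \<in> V \<Longrightarrow> j \<le> r \<Longrightarrow> lift u (c v j) = u j"
  by (simp add: lift_def cone_vertex_in)

lemma flatten_below_lift: "j \<le> r \<Longrightarrow> flatten_below j (lift u) = lift u"
proof (induction j)
  case (Suc j)
  obtain a b where ab: "(a, b) \<in> E" using arcs_nonempty by auto
  have ex: "\<exists>a b. (a, b) \<in> E \<and> lift u (c a j) = lift u (c b j)"
    using ab E_verts[OF ab] Suc.prems by (intro exI[of _ a] exI[of _ b]) (simp add: lift_at)
  obtain a' b' where a': "(a', b') \<in> E" "\<And>v. v \<in> V \<Longrightarrow> flatten j (lift u) (c v j) = lift u (c a' j)"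
    by (rule flatten_at[OF ex Suc_leD[OF Suc.prems]]) blast
  have "flatten j (lift u) X = lift u X" for X
  proof (cases "X \<in> pverts G")
    case True
    then obtain v k where v: "X = c v k" "v \<in> V" "k \<le> r" by (auto simp: pverts_gen_cone)
    show ?thesis
    proof (cases "k = j")
      case True
      with v a'(2)[OF v(2)] E_verts(1)[OF a'(1)] show ?thesis by (simp only: lift_at)
    next
      case False
      with v show ?thesis using flatten_other[OF v(2,3) False] by simp
    qed
  qed (simp only: flatten_def lift_def restrict_apply if_False)
  then have "flatten j (lift u) = lift u" by (rule ext)
  then show ?case using Suc by simp
qed simp

text \<open>
  After all levels below the apex are flattened, a map is determined by one color for each level;
  the apex is a single vertex. Lifting a map from the path inverts this: flattening does not change a
  lift, and the lift of the profile of \<open>f\<close> is the flattening of \<open>f\<close>.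
\<close>

theorem homotopy_equivalent_exp_path:
  "geom_realization (nbhd_complex H) homotopy_equivalent_space
   geom_realization (nbhd_complex (exp_graph (complete_graph m) L))"
proof -
  let ?P = "exp_graph (complete_graph m) L"
  note P_edge = exp_complete_edge_iff[OF pair_wf_digraph_looped_path[OF i_less], of _ _ m]
  obtain a b where ab: "(a, b) \<in> E" using arcs_nonempty by auto
  note abV = E_verts[OF ab]
  define profile where "profile f = (\<lambda>j\<in>{0..r}. flatten_below r f (c a j))" for f
  have flat: "flatten_below r f (c v j) = flatten_below r f (c w j)"
    if "(f, g) \<in> parcs H" "v \<in> V" "w \<in> V" "j \<le> r" for f g v w j
  proof (cases "j = r")
    case True
    then show ?thesis using cone_vertex_top[of T r v w] by simp
  next
    case False
    with that(4) have "j < r" by simp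
    then show ?thesis
      using flatten_below_edge[OF that(1) order_refl] that(2,3) unfolding flat_below_def by blast
  qed
  have profile_edge: "(profile f, profile g) \<in> parcs ?P" if fg: "(f, g) \<in> parcs H" for f g
  proof -
    note e = conjunct1[OF flatten_below_edge[OF fg order_refl]]
    have "profile f j \<noteq> profile g k" if jk: "(j, k) \<in> parcs L" for j k
    proof -
      have "j \<le> r" "k \<le> r" using jk i_less by (auto simp: path_edge)
      then show ?thesis
        using H_edge_neq[OF e ab jk] flat[OF H_edge_sym[OF fg] abV] by (simp add: profile_def)
    qed
    moreover have "profile f \<in> {0..r} \<rightarrow>\<^sub>E {1..m}" "profile g \<in> {0..r} \<rightarrow>\<^sub>E {1..m}"
      using H_edge_color[OF e abV(1)] H_edge_color[OF H_edge_sym[OF e] abV(1)]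
      unfolding profile_def by (simp_all add: restrict_PiE_iff)
    ultimately show ?thesis unfolding P_edge pverts_looped_path by blast
  qed
  have lift_edge: "(lift u, lift u') \<in> parcs H" if uu': "(u, u') \<in> parcs ?P" for u u'
  proof -
    have "lift u (c v j) \<noteq> lift u' (c w k)" if vw: "(v, w) \<in> E" and jk: "(j, k) \<in> parcs L" for v w j k
    proof -
      have "j \<le> r" "k \<le> r" using jk i_less by (auto simp: path_edge)
      then show ?thesis using uu' jk E_verts[OF vw] by (auto simp: lift_at P_edge)
    qed
    moreover have "lift u \<in> pverts G \<rightarrow>\<^sub>E {1..m}" if u: "u \<in> {0..r} \<rightarrow>\<^sub>E {1..m}" for u
    proof
      fix X assume "X \<in> pverts G"
      then obtain v j where "X = c v j" "v \<in> V" "j \<le> r" by (auto simp: pverts_gen_cone)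
      then show "lift u X \<in> {1..m}" using PiE_mem[OF u, of j] by (simp add: lift_at)
    qed (simp add: lift_def)
    moreover have "u \<in> {0..r} \<rightarrow>\<^sub>E {1..m}" "u' \<in> {0..r} \<rightarrow>\<^sub>E {1..m}"
      using uu' unfolding P_edge pverts_looped_path by simp_all
    ultimately show ?thesis by (intro H_edgeI) simp_all
  qed
  have lift_profile: "lift (profile f) = flatten_below r f" if fg: "(f, g) \<in> parcs H" for f g
  proof
    fix X
    show "lift (profile f) X = flatten_below r f X"
    proof (cases "X \<in> pverts G")
      case True
      then obtain v j where "X = c v j" "v \<in> V" "j \<le> r" by (auto simp: pverts_gen_cone)
      then show ?thesis using flat[OF fg abV(1), of v j] by (simp add: lift_at profile_def)
    next
      case False
      have "flatten_below r f \<in> extensional (pverts G)"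
        using H_edge_coloring[OF conjunct1[OF flatten_below_edge[OF fg order_refl]]] by (simp add: PiE_iff)
      with False show ?thesis by (simp add: lift_def extensional_def)
    qed
  qed
  have profile_lift: "profile (lift u) = u" if "(u, u') \<in> parcs ?P" for u u'
  proof
    fix j show "profile (lift u) j = u j"
      using that abV by (cases "j \<le> r") (simp_all add: profile_def flatten_below_lift lift_at P_edge PiE_iff extensional_def)
  qed
  have sym_P: "(u', u) \<in> parcs ?P" if "(u, u') \<in> parcs ?P" for u u'
  proof -
    have "u' j \<noteq> u k" if "(j, k) \<in> parcs L" for j k
      using \<open>(u, u') \<in> parcs ?P\<close> path_sym[OF that] unfolding P_edge by force
    with that show ?thesis unfolding P_edge by blast
  qed
  show ?thesis
  proof (rule homotopy_equivalent_nbhd_complexes[where \<phi> = profile and \<psi> = lift])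
    show "times_adjacent H ?P profile profile" using profile_edge by (auto simp: times_adjacent_def)
    show "times_adjacent ?P H lift lift" using lift_edge by (auto simp: times_adjacent_def)
    have "times_adjacent H H (lift \<circ> profile) (flatten_below r)"
      unfolding times_adjacent_def
    proof clarify
      fix f g assume fg: "(f, g) \<in> parcs H"
      show "((lift \<circ> profile) f, (lift \<circ> profile) g) \<in> parcs H \<and>
          (flatten_below r f, flatten_below r g) \<in> parcs H \<and>
          ((lift \<circ> profile) f, flatten_below r g) \<in> parcs H"
        using flatten_below_edge[OF fg order_refl] lift_profile[OF fg] lift_profile[OF H_edge_sym[OF fg]]
        by simp
    qed
    then show "(times_adjacent H H)\<^sup>*\<^sup>* (lift \<circ> profile) id"
      using flatten_below_chain[OF order_refl] by (rule converse_rtranclp_into_rtranclp)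
    have "times_adjacent ?P ?P (profile \<circ> lift) id"
      unfolding times_adjacent_def
    proof clarify
      fix u u' assume uu': "(u, u') \<in> parcs ?P"
      show "((profile \<circ> lift) u, (profile \<circ> lift) u') \<in> parcs ?P \<and> (id u, id u') \<in> parcs ?P \<and>
          ((profile \<circ> lift) u, id u') \<in> parcs ?P"
        using uu' profile_lift[OF uu'] profile_lift[OF sym_P[OF uu']] by simp
    qed
    then show "(times_adjacent ?P ?P)\<^sup>*\<^sup>* (profile \<circ> lift) id" by blast
  qed (simp_all add: pair_wf_digraph_exp_graph finite_exp_graph finite_cone)
qed

end

lemma (in coned_coloring) nbhd_complex_sphere:
  assumes "1 \<le> m"
  shows "geom_realization (nbhd_complex H) homotopy_equivalent_space sphere_space (int m - 2)"
  using homotopy_equivalent_exp_path nbhd_complex_exp_looped_path[OF i_less]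
    complete_graph_sphere[OF assms] by (blast intro: homotopy_eqv_trans)

section \<open>Graphs with property P\<close>

text \<open>
  The vertices adjacent to \<open>a\<close> or \<open>b\<close> include \<open>a\<close> and \<open>b\<close>, and the set is closed under passing to
  neighbors: for an edge disjoint from \<open>{a, b}\<close> this is property P. Connectedness gives all vertices.
\<close>

lemma property_P_dominating:
  assumes T: "pair_graph T" and con: "Digraph_Component.connected (with_proj T)" and P: "property_P T"
    and ab: "(a, b) \<in> parcs T" and v: "v \<in> pverts T"
  shows "(v, a) \<in> parcs T \<or> (v, b) \<in> parcs T"
proof -
  interpret pair_graph T by (rule T)
  have sym: "(y, x) \<in> parcs T" if "(x, y) \<in> parcs T" for x y
    using that pair_sym_arcs by (simp add: symmetric_def sym_def)
  have "a \<rightarrow>\<^sup>*\<^bsub>mk_symmetric (with_proj T)\<^esub> v"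
    using con v in_arcsD1[OF ab] unfolding connected_def strongly_connected_def by simp
  then have "(a, v) \<in> rtrancl_on (pverts T) (parcs (mk_symmetric (with_proj T)))"
    unfolding reachable_def by simp
  then show ?thesis
  proof (induction rule: rtrancl_on_induct)
    case base
    with ab show ?case by blast
  next
    case (step x y)
    have xy: "(x, y) \<in> parcs T"
      using step(2) sym by (auto simp: parcs_mk_symmetric)
    show ?case
    proof (cases "{a, b} \<inter> {x, y} = {}")
      case True
      have swap: "{b, a} \<inter> {x, y} = {}" using True by blast
      have P': "(y, v1) \<in> parcs T \<or> (y, w1) \<in> parcs T"
        if "(v1, w1) \<in> parcs T" "{v1, w1} \<inter> {x, y} = {}" "(x, v1) \<in> parcs T" for v1 w1
        using P that xy unfolding property_P_def by blast
      from step(5) show ?thesis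
      proof
        assume "(x, a) \<in> parcs T"
        from P'[OF ab True this] show ?thesis .
      next
        assume "(x, b) \<in> parcs T"
        from P'[OF sym[OF ab] swap this] show ?thesis by blast
      qed
    next
      case False
      with ab sym[OF ab] sym[OF xy] show ?thesis by blast
    qed
  qed
qed

lemma complete_graph_not_colorable:
  assumes "k < n"
  shows "\<not> graph_hom (complete_graph n) (complete_graph k) f"
proof
  assume f: "graph_hom (complete_graph n) (complete_graph k) f"
  have "inj_on f {1..n}"
  proof (rule inj_onI, rule ccontr)
    fix x y assume xy: "x \<in> {1..n}" "y \<in> {1..n}" "f x = f y" "x \<noteq> y"
    then have "(x, y) \<in> parcs (complete_graph n)" by (simp add: complete_graph_def)
    with f have "(f x, f y) \<in> parcs (complete_graph k)" unfolding graph_hom_def by blast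
    with xy(3) show False by (simp add: complete_graph_def)
  qed
  moreover have "f ` {1..n} \<subseteq> {1..k}" using f by (auto simp: graph_hom_def complete_graph_def)
  ultimately have "card {1..n} \<le> card {1..k}" by (intro card_inj_on_le) auto
  with assms show False by simp
qed

lemma coned_coloring_of_property_P:
  assumes "pair_graph T" "Digraph_Component.connected (with_proj T)" "parcs T \<noteq> {}" "property_P T"
    and "m \<le> chromatic_number T" "i < r"
  shows "coned_coloring T m r i"
proof -
  interpret pair_graph T by (rule assms(1))
  show ?thesis
  proof
    show "(w, v) \<in> parcs T" if "(v, w) \<in> parcs T" for v w
      using that pair_sym_arcs by (simp add: symmetric_def sym_def)
    show "(v, a) \<in> parcs T \<or> (v, b) \<in> parcs T" if "(a, b) \<in> parcs T" "v \<in> pverts T" for a b v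
      by (rule property_P_dominating[OF assms(1,2,4) that])
    show "\<not> graph_hom T (complete_graph k) f" if "k < m" for k f
      using not_less_Least[of k "\<lambda>n. \<exists>f. graph_hom T (complete_graph n) f"] that assms(5)
      unfolding chromatic_number_def by auto
  qed (use assms pair_finite_verts in simp_all)
qed

lemma coned_coloring_complete_graph:
  assumes "2 \<le> n" "m \<le> n" "i < r"
  shows "coned_coloring (complete_graph n) m r i"
proof -
  interpret pair_wf_digraph "complete_graph n" by (rule pair_wf_digraph_complete_graph)
  show ?thesis
  proof
    have "(1, 2) \<in> parcs (complete_graph n)" using assms(1) by (simp add: complete_graph_def)
    then show "parcs (complete_graph n) \<noteq> {}" by blast
    show "\<not> graph_hom (complete_graph n) (complete_graph k) f" if "k < m" for k f
      using that assms(2) by (intro complete_graph_not_colorable) simp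
  qed (use assms in \<open>auto simp: complete_graph_def\<close>)
qed

theorem theorem1p3:
  fixes n r i :: nat and A :: "nat set"
  assumes "n \<ge> 2" and "r \<ge> 1" and "0 \<le> i" and "i \<le> r - 1" and "A = {0..i}"
  shows "(\<forall>T :: 'a pair_pre_digraph.
            pair_graph T \<and> Digraph_Component.connected (with_proj T) \<and> parcs T \<noteq> {} \<and>
            property_P T \<longrightarrow>
            (\<forall>m. 1 \<le> m \<and> m \<le> chromatic_number T \<longrightarrow>
               geom_realization (nbhd_complex (exp_graph (complete_graph m) (gen_cone T r A)))
                 homotopy_equivalent_space sphere_space (int m - 2)))
       \<and> (r \<ge> 2 \<longrightarrow>
            (\<forall>m. 1 \<le> m \<and> m \<le> n \<longrightarrow>
               geom_realization
                 (nbhd_complex (exp_graph (complete_graph m) (mycielskian r (complete_graph n))))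
                 homotopy_equivalent_space sphere_space (int m - 2)))"
proof (intro conjI allI impI)
  fix T :: "'a pair_pre_digraph" and m
  assume T: "pair_graph T \<and> Digraph_Component.connected (with_proj T) \<and> parcs T \<noteq> {} \<and> property_P T"
    and m: "1 \<le> m \<and> m \<le> chromatic_number T"
  have "i < r" using assms(2,4) by linarith
  with T m have "coned_coloring T m r i" by (intro coned_coloring_of_property_P) simp_all
  from coned_coloring.nbhd_complex_sphere[OF this] m
  show "geom_realization (nbhd_complex (exp_graph (complete_graph m) (gen_cone T r A)))
      homotopy_equivalent_space sphere_space (int m - 2)"
    unfolding assms(5) by blast
next
  fix m assume m: "1 \<le> m \<and> m \<le> n"
  have "coned_coloring (complete_graph n) m r 0"
    using assms(1,2) m by (intro coned_coloring_complete_graph) simp_all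
  from coned_coloring.nbhd_complex_sphere[OF this] m
  show "geom_realization (nbhd_complex (exp_graph (complete_graph m) (mycielskian r (complete_graph n))))
      homotopy_equivalent_space sphere_space (int m - 2)"
    unfolding mycielskian_def by simp
qed

end
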